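(* Let $\dot{x}=f(x,u)$ be a continuous-time system in structurally flat triangular form (as defined in the context, including its rank conditions), with an equilibrium $(x_s,u_s)$. Let $T_s>0$ be a sufficiently small sampling time, so that the implicit Euler-discretization $x^{+}=x+T_s f(x^{+},u)$ possesses an explicit state representation $x^{+}=\tilde f(x,u)$ in a neighborhood of $(x_s,u_s)$. Then the discrete-time system $x^{+}=\tilde f(x,u)$ is flat.
   Context: All functions are smooth, and all statements are local around the equilibrium $(x_s,u_s)$, $f(x_s,u_s)=0$. $\dim(x)=n$, $\dim(u)=m$; $x^+$ denotes the forward-shift of $x$. **Structurally flat triangular form.** A continuous-time system $\dot x=f(x,u)$ is in structurally flat triangular form if it is decomposed into $p$ subsystems $$\begin{aligned}\dot{x}_{p} &= f_{p}(x_{p},x_{p-1},u_{p-1})\\ \dot{x}_{p-1} &= f_{p-1}(x_{p},x_{p-1},x_{p-2},u_{p-1},u_{p-2})\\ &\ \vdots\\ \dot{x}_{2} &= f_{2}(x_{p},\dots,x_{1},u_{p-1},\dots,u_{1})\\ \dot{x}_{1} &= f_{1}(x_{p},\dots,x_{1},u_{p-1},\dots,u_{1},u_{0})\end{aligned}$$ (i.e. for $k\ge 2$, $f_k$ depends only on $x_p,\dots,x_{k-1},u_{p-1},\dots,u_{k-1}$), where each $x_k$ and $u_k$ is a block of variables, $\dim(x_k)=\dim(f_k)\ge 1$, the state is $$x=(x_{p},x_{p-1},\dots,x_{1})=(y_{p},(y_{p-1},\hat{x}_{p-1}),\dots,(y_{1},\hat{x}_{1})),$$ i.e. $x_p=y_p$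 and $x_k=(y_k,\hat x_k)$ for $k=1,\dots,p-1$, the input is $u=(u_{p-1},\dots,u_0)$ (components $y_k$ and/or $u_k$ may be empty), and the following rank conditions hold: $$\mathrm{rank}(\partial_{u_{0}}f_{1})=\dim(f_{1})=\dim(u_{0}),\qquad \mathrm{rank}(\partial_{(\hat{x}_{k},u_{k})}f_{k+1})=\dim(f_{k+1})=\dim((\hat{x}_{k},u_{k})),\quad k=1,\dots,p-1.$$ **State representation.** A state representation of $x^{+}=x+T_s f(x^{+},u)$ near $(x_s,u_s)$ is a smooth map $\tilde f$ defined near $(x_s,u_s)$ such that, for $(x,u)$ near $(x_s,u_s)$ and $x^+$ near $x_s$, $x^{+}=x+T_s f(x^{+},u)$ is equivalent to $x^{+}=\tilde f(x,u)$. It exists for all sufficiently small $T_s>0$. **Discrete-time flatness.** A discrete-time system $x^{+}=\tilde f(x,u)$ whose Jacobian satisfies the submersivity condition $\mathrm{rank}(\partial_{(x,u)}\tilde f)=n$ is flat if there is a one-to-one correspondence between its trajectories $(x(k),u(k))$ and trajectories $y(k)$, $\dim(y)=m$, of a trivial system (arbitrary sequences that need not satisfy any difference equation), expressed by two smooth maps $$(x(k),u(k))=F(y(k-r_1),\dots,y(k+r_2)),$$ $$y(k)=\varphi(x(k-q_1),u(k-q_1),\dots,x(k+q_2),u(k+q_2))$$ with some integers $r_1,r_2,q_1,q_2\ge 0$, such that: substituting the first map (and its shift for $x(k+1)$) into $x(k+1)=\tilde f(x(k),u(k))$ yields an identity in the arbitrary sequence $y$; composing $\varphi$ with the occurring shifts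 of $F$ yields the identity $y(k)=y(k)$; and composing $F$ with the occurring shifts of $\varphi$ yields the identity $(x(k),u(k))=(x(k),u(k))$ along all trajectories of the system. Here flatness is understood locally: the maps are defined near the values corresponding to the equilibrium, and the trajectories remain sufficiently close to the equilibrium. *)

theory Defs
  imports "HOL-Analysis.Analysis"
begin

text \<open>
  \<open>k\<close>-fold continuous differentiability through iterated directional derivatives; on open
  subsets of a finite-dimensional domain this is the usual notion of a \<open>C\<^sup>k\<close> map.
\<close>

primrec Ck_on :: "nat \<Rightarrow> 'a::real_normed_vector set \<Rightarrow> ('a \<Rightarrow> 'b::real_normed_vector) \<Rightarrow> bool" where
  "Ck_on 0 S f \<longleftrightarrow> continuous_on S f"
| "Ck_on (Suc k) S f \<longleftrightarrow> (\<forall>x\<in>S. f differentiable (at x)) \<and>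
     (\<forall>v. Ck_on k S (\<lambda>x. frechet_derivative f (at x) v))"

definition smooth_on :: "'a::real_normed_vector set \<Rightarrow> ('a \<Rightarrow> 'b::real_normed_vector) \<Rightarrow> bool" where
  "smooth_on S f \<longleftrightarrow> open S \<and> (\<forall>k. Ck_on k S f)"

text \<open>
  The block of the Jacobian of \<open>f\<close> at \<open>z = (x, u)\<close> with the rows in \<open>R\<close> and the columns of the
  state components in \<open>A\<close> and of the input components in \<open>B\<close>. The remaining entries are set
  to zero instead of being deleted, which does not affect the rank.
\<close>

definition jacobian_block ::
  "((real^'n) \<times> (real^'m) \<Rightarrow> real^'n) \<Rightarrow> (real^'n) \<times> (real^'m) \<Rightarrow> 'n set \<Rightarrow> 'n set \<Rightarrow> 'm set
    \<Rightarrow> real^('n::finite + 'm::finite)^'n" where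
  "jacobian_block f z R A B = (\<chi> i c.
     if i \<in> R then
       (case c of
          Inl l \<Rightarrow> if l \<in> A then frechet_derivative f (at z) (axis l 1, 0) $ i else 0
        | Inr j \<Rightarrow> if j \<in> B then frechet_derivative f (at z) (0, axis j 1) $ i else 0)
     else 0)"

text \<open>
  The block decomposition is given by labels: \<open>xb i \<in> {1..p}\<close> and \<open>ub j \<in> {0..p-1}\<close> are the
  numbers of the blocks containing the \<open>i\<close>-th state and the \<open>j\<close>-th input component, and \<open>H\<close> is
  the set of those state components that belong to the part \<open>xhat\<^sub>k\<close> of some block
  \<open>x\<^sub>k = (y\<^sub>k, xhat\<^sub>k)\<close> (the others belong to the \<open>y\<^sub>k\<close>).
  The \<open>i\<close>-th component of \<open>f\<close> belongs to the same block as the \<open>i\<close>-th state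
  component. As there is no block \<open>x\<^sub>0\<close>, the case \<open>k = 0\<close> of the rank conditions is
  the one for the Jacobian of \<open>f\<^sub>1\<close> with respect to \<open>u\<^sub>0\<close>.
\<close>

definition structurally_flat_triangular_on ::
  "((real^'n::finite) \<times> (real^'m::finite)) set \<Rightarrow> nat \<Rightarrow> ('n \<Rightarrow> nat) \<Rightarrow> 'n set \<Rightarrow> ('m \<Rightarrow> nat)
    \<Rightarrow> ((real^'n) \<times> (real^'m) \<Rightarrow> real^'n) \<Rightarrow> bool"
  where
  "structurally_flat_triangular_on D p xb H ub f \<longleftrightarrow>
     1 \<le> p \<and> range xb = {1..p} \<and> (\<forall>i\<in>H. xb i < p) \<and> (\<forall>j. ub j < p) \<and>
     (\<forall>i. \<forall>(x, u)\<in>D. \<forall>(x', u')\<in>D.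
        (\<forall>l. xb i - 1 \<le> xb l \<longrightarrow> x $ l = x' $ l) \<and>
        (\<forall>j. xb i - 1 \<le> ub j \<longrightarrow> u $ j = u' $ j) \<longrightarrow> f (x, u) $ i = f (x', u') $ i) \<and>
     (\<forall>k<p.
        card {i. xb i = k + 1} = card {l \<in> H. xb l = k} + card {j. ub j = k} \<and>
        (\<forall>z\<in>D. rank (jacobian_block f z {i. xb i = k + 1} {l \<in> H. xb l = k} {j. ub j = k})
                 = card {i. xb i = k + 1}))"

definition state_representation ::
  "((real^'n) \<times> (real^'m) \<Rightarrow> real^'n) \<Rightarrow> real \<Rightarrow> real^('n::finite) \<Rightarrow> real^('m::finite)
    \<Rightarrow> ((real^'n) \<times> (real^'m) \<Rightarrow> real^'n) \<Rightarrow> bool" where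
  "state_representation f T xs us g \<longleftrightarrow>
     (\<exists>W V. open W \<and> (xs, us) \<in> W \<and> open V \<and> xs \<in> V \<and> smooth_on W g \<and>
        (\<forall>(x, u)\<in>W. \<forall>x'\<in>V. x' = x + T *\<^sub>R f (x', u) \<longleftrightarrow> x' = g (x, u)))"

definition shift :: "int \<Rightarrow> (int \<Rightarrow> 'a) \<Rightarrow> int \<Rightarrow> 'a" where
  "shift k s = (\<lambda>j. s (k + j))"

text \<open>
  A map \<open>G(s(-a), \<dots>, s(b))\<close> of finitely many vector arguments that is smooth near
  \<open>(c, \<dots>, c)\<close>. Since \<open>a\<close> and \<open>b\<close> vary, \<open>G\<close> takes a whole sequence as argument, of which it uses
  only the indicated entries, and smoothness is expressed on the normed space of bounded
  sequences. As \<open>G\<close> factors through the projection to finitely many entries, this is the same as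
  smoothness in these entries.
\<close>

definition smooth_window_map ::
  "nat \<Rightarrow> nat \<Rightarrow> 'a::real_normed_vector \<Rightarrow> ((int \<Rightarrow> 'a) \<Rightarrow> 'b::real_normed_vector) \<Rightarrow> bool" where
  "smooth_window_map a b c G \<longleftrightarrow>
     (\<forall>s s'. (\<forall>j\<in>{- int a..int b}. s j = s' j) \<longrightarrow> G s = G s') \<and>
     (\<exists>\<delta>>0. smooth_on (ball (const_bcontfun c) \<delta>)
              (\<lambda>s :: int \<Rightarrow>\<^sub>C 'a. G (apply_bcontfun s)))"

definition submersive_near ::
  "((real^'n) \<times> (real^'m) \<Rightarrow> real^'n) \<Rightarrow> (real^'n::finite) \<times> (real^'m::finite) \<Rightarrow> bool" where
  "submersive_near g z0 \<longleftrightarrow>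
     (\<exists>W. z0 \<in> W \<and> smooth_on W g \<and>
        (\<forall>z\<in>W. rank (jacobian_block g z UNIV UNIV UNIV) = CARD('n)))"

text \<open>
  Local flatness of \<open>x\<^sup>+ = g(x, u)\<close> at the equilibrium \<open>(xs, us)\<close>. In the last identity, the
  trajectory is required to exist and to be close to the equilibrium only on the time window
  that occurs in the identity. Demanding this for all times would be too weak a notion: the
  uncontrollable system \<open>x\<^sup>+ = 2 x\<close> with an additional input that has no influence
  would then be flat, since \<open>x = 0\<close> is its only trajectory that stays small in both directions.
\<close>

definition flat_at ::
  "((real^'n) \<times> (real^'m) \<Rightarrow> real^'n) \<Rightarrow> real^('n::finite) \<Rightarrow> real^('m::finite) \<Rightarrow> bool" where
  "flat_at g xs us \<longleftrightarrow>
     submersive_near g (xs, us) \<and>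
     (\<exists>r1 r2 q1 q2 (ys :: real^'m) F \<phi>.
        smooth_window_map r1 r2 ys F \<and> F (\<lambda>_. ys) = (xs, us) \<and>
        smooth_window_map q1 q2 (xs, us) \<phi> \<and> \<phi> (\<lambda>_. (xs, us)) = ys \<and>
        (\<exists>\<epsilon>>0.
           (\<forall>y k. (\<forall>j. dist (y j) ys < \<epsilon>) \<longrightarrow>
              fst (F (shift (k + 1) y)) = g (F (shift k y))) \<and>
           (\<forall>y k. (\<forall>j. dist (y j) ys < \<epsilon>) \<longrightarrow>
              \<phi> (\<lambda>j. F (shift (k + j) y)) = y k) \<and>
           (\<forall>z k.
              (\<forall>j\<in>{k - int (r1 + q1)..k + int (r2 + q2)}. dist (z j) (xs, us) < \<epsilon>) \<and>
              (\<forall>j\<in>{k - int (r1 + q1)..<k + int (r2 + q2)}. fst (z (j + 1)) = g (z j)) \<longrightarrow>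
              F (\<lambda>j. \<phi> (shift (k + j) z)) = z k)))"

end

theory Submission
  imports Defs
begin

text \<open>
  The flat output consists of the state components that belong to the blocks \<open>y\<^sub>p, \<dots>, y\<^sub>1\<close>, exactly as
  for the continuous-time system. By the dimension conditions there are as many of them as there are
  inputs.

  For the implicit Euler discretization the argument is that of the continuous-time case with
  \<open>x\<^sup>+\<close> in place of the derivative. The equation for block \<open>k + 1\<close> reads
  \<open>x\<^sub>k\<^sub>+\<^sub>1\<^sup>+ = x\<^sub>k\<^sub>+\<^sub>1 + T f\<^sub>k\<^sub>+\<^sub>1 (x\<^sub>p\<^sup>+, \<dots>, x\<^sub>k\<^sup>+, u\<^sub>p\<^sub>-\<^sub>1, \<dots>, u\<^sub>k)\<close>. If the higher blocks of \<open>x\<^sup>+\<close> and \<open>u\<close>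
  as well as \<open>y\<^sub>k\<^sup>+\<close> are known, the rank condition allows one to solve it for \<open>xhat\<^sub>k\<^sup>+\<close> and \<open>u\<^sub>k\<close>. It is
  essential here that \<open>f\<close> is evaluated at \<open>x\<^sup>+\<close>: the unknowns of all these equations together are the
  components of the single vector \<open>w = (x\<^sup>+, u)\<close>.

  Instead of solving block by block, the proof inverts once the map
  \<open>\<Theta> w = (x\<^sup>+ - T f (x\<^sup>+, u), y\<^sup>+)\<close>, whose value is \<open>(x, y\<^sup>+)\<close>. Its derivative is block triangular with
  invertible diagonal blocks (\<open>derivative_\<Theta>_upper_blocks\<close>), so it has a smooth local inverse
  \<open>h\<close> with \<open>(x\<^sup>+, u) = h (x, y\<^sup>+)\<close> along trajectories. The triangular structure is inherited by \<open>h\<close>: the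
  blocks \<open>x\<^sub>p\<^sup>+, \<dots>, x\<^sub>j\<^sup>+\<close> depend, besides \<open>y\<^sup>+\<close>, on \<open>x\<^sub>p, \<dots>, x\<^sub>j\<^sub>+\<^sub>1\<close> only (\<open>h_upper_blocks_cong\<close>).
  Each application of \<open>h\<close> thus makes the state independent of one more block of the state it started
  from. After \<open>p\<close> steps it depends on the outputs alone (\<open>approx_eq_trajectory\<close>), and one
  further application of \<open>h\<close> yields the input.

  For every \<open>T\<close>, a state representation \<open>g\<close> only enters through its equivalence with the implicit
  equation near the equilibrium. The latter also yields the submersivity of \<open>g\<close>, while the existence
  of \<open>g\<close> for small \<open>T\<close> is the implicit function theorem.

  Since \<open>Ck_on\<close> is defined by iterated directional derivatives on arbitrary normed spaces, the closure of
  \<open>C\<^sup>k\<close> maps under products, composition and inversion is established first. The composition rule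
  covers inner maps on the space of bounded sequences, where the smoothness of the
  reconstruction is expressed.
\<close>

section \<open>Calculus of \<open>C\<^sup>k\<close> maps\<close>

lemma Ck_on_cong_imp:
  assumes "open S" "\<And>x. x \<in> S \<Longrightarrow> f x = g x" "Ck_on k S f"
  shows "Ck_on k S g"
  using assms(2,3)
proof (induction k arbitrary: f g)
  case 0
  then show ?case by (auto cong: continuous_on_cong)
next
  case (Suc k)
  have d: "f differentiable at x" if "x \<in> S" for x
    using Suc.prems that by auto
  have dg: "g differentiable at x" if "x \<in> S" for x
    using d[OF that] has_derivative_transform_within_open[OF _ assms(1) that] Suc.prems(1)
    unfolding differentiable_def by metis
  have e: "frechet_derivative f (at x) = frechet_derivative g (at x)" if "x \<in> S" for x
    using frechet_derivative_transform_within_open[OF d[OF that] assms(1) that] Suc.prems(1) by blast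
  have "Ck_on k S (\<lambda>x. frechet_derivative g (at x) v)" for v
    by (rule Suc.IH[of "\<lambda>x. frechet_derivative f (at x) v"]) (use e Suc.prems in auto)
  then show ?case using dg by simp
qed

text \<open>
  Any explicit formula for the derivative may be used in place of \<open>frechet_derivative\<close>; all
  closure properties below are obtained by induction on \<open>k\<close> from such a formula.
\<close>

lemma Ck_on_SucI:
  assumes "open S" "\<And>x. x \<in> S \<Longrightarrow> (f has_derivative f' x) (at x)"
    and "\<And>v. Ck_on k S (\<lambda>x. f' x v)"
  shows "Ck_on (Suc k) S f"
proof -
  have "Ck_on k S (\<lambda>x. frechet_derivative f (at x) v)" for v
    by (rule Ck_on_cong_imp[OF assms(1) _ assms(3)[of v]])
       (use frechet_derivative_at[OF assms(2)] in auto)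
  then show ?thesis
    using assms(2) by (auto simp: differentiable_def)
qed

lemma Ck_on_subset: "Ck_on k S f \<Longrightarrow> T \<subseteq> S \<Longrightarrow> Ck_on k T f"
  by (induction k arbitrary: f) (auto intro: continuous_on_subset)

lemma Ck_on_Suc_continuous_on: "Ck_on (Suc k) S f \<Longrightarrow> continuous_on S f"
  by (auto intro!: continuous_at_imp_continuous_on differentiable_imp_continuous_within)

lemma Ck_on_SucD: "Ck_on (Suc k) S f \<Longrightarrow> Ck_on k S f"
proof (induction k arbitrary: f)
  case 0
  then show ?case using Ck_on_Suc_continuous_on[of 0 S f] by simp
next
  case (Suc k)
  then show ?case by (metis Ck_on.simps(2))
qed

lemma Ck_on_const: "Ck_on k S (\<lambda>x. c)"
  by (induction k arbitrary: c) auto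

lemma Ck_on_bounded_linear_compose:
  assumes "bounded_linear L" "open S" "Ck_on k S f"
  shows "Ck_on k S (\<lambda>x. L (f x))"
  using assms(3)
proof (induction k arbitrary: f)
  case 0
  then show ?case
    by (auto intro: bounded_linear.continuous_on assms)
next
  case (Suc k)
  show ?case
  proof (rule Ck_on_SucI[OF assms(2)])
    show "((\<lambda>x. L (f x)) has_derivative (\<lambda>v. L (frechet_derivative f (at x) v))) (at x)" if "x \<in> S" for x
      using Suc.prems that
      by (auto intro!: bounded_linear.has_derivative[OF assms(1)] simp: frechet_derivative_works[symmetric])
  qed (use Suc in auto)
qed

lemma Ck_on_id: "open S \<Longrightarrow> Ck_on k S (\<lambda>x. x)"
  by (cases k) (auto simp: Ck_on_const)

lemma Ck_on_bounded_linear: "bounded_linear L \<Longrightarrow> open S \<Longrightarrow> Ck_on k S L"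
  using Ck_on_bounded_linear_compose[OF _ _ Ck_on_id] .

lemma Ck_on_add:
  assumes "open S" "Ck_on k S f" "Ck_on k S g"
  shows "Ck_on k S (\<lambda>x. f x + g x)"
  using assms(2,3)
proof (induction k arbitrary: f g)
  case 0
  then show ?case by (auto intro: continuous_intros)
next
  case (Suc k)
  show ?case
  proof (rule Ck_on_SucI[OF assms(1)])
    show "((\<lambda>x. f x + g x) has_derivative
        (\<lambda>v. frechet_derivative f (at x) v + frechet_derivative g (at x) v)) (at x)" if "x \<in> S" for x
      using Suc.prems that
      by (auto intro!: has_derivative_add simp: frechet_derivative_works[symmetric])
  qed (use Suc in auto)
qed

lemma Ck_on_sum:
  assumes "open S" "\<And>i. i \<in> I \<Longrightarrow> Ck_on k S (f i)"
  shows "Ck_on k S (\<lambda>x. \<Sum>i\<in>I. f i x)"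
  using assms(2)
  by (induction I rule: infinite_finite_induct) (auto intro: Ck_on_const Ck_on_add[OF assms(1)])

lemma Ck_on_scaleR:
  fixes a :: "'a::real_normed_vector \<Rightarrow> real"
  assumes "open S" "Ck_on k S a" "Ck_on k S f"
  shows "Ck_on k S (\<lambda>x. a x *\<^sub>R f x)"
  using assms(2,3)
proof (induction k arbitrary: a f)
  case 0
  then show ?case by (auto intro: continuous_intros)
next
  case (Suc k)
  note lower = Suc.prems[THEN Ck_on_SucD]
  show ?case
  proof (rule Ck_on_SucI[OF assms(1)])
    show "((\<lambda>x. a x *\<^sub>R f x) has_derivative
        (\<lambda>v. a x *\<^sub>R frechet_derivative f (at x) v + frechet_derivative a (at x) v *\<^sub>R f x)) (at x)"
      if "x \<in> S" for x
      using Suc.prems that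
      by (auto intro!: has_derivative_scaleR simp: frechet_derivative_works[symmetric])
    show "Ck_on k S (\<lambda>x. a x *\<^sub>R frechet_derivative f (at x) v + frechet_derivative a (at x) v *\<^sub>R f x)" for v
      using Suc.prems lower by (intro Ck_on_add[OF assms(1)] Suc.IH) auto
  qed
qed

text \<open>
  The domain of the inner map may have infinite dimension, which is what makes the lemma
  applicable to maps on spaces of sequences. Only the space in the middle has to be Euclidean: there
  the chain rule becomes a finite sum of products of partial derivatives, to which the induction
  hypothesis applies factor by factor.
\<close>

lemma Ck_on_compose:
  fixes f :: "'a::real_normed_vector \<Rightarrow> 'b::euclidean_space"
  assumes "open S" "open T" "Ck_on k S f" "Ck_on k T g" "f ` S \<subseteq> T"
  shows "Ck_on k S (\<lambda>x. g (f x))"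
  using assms(3,4)
proof (induction k arbitrary: g)
  case 0
  then show ?case using assms(5) by (auto intro: continuous_on_compose2)
next
  case (Suc k)
  note lower = Suc.prems(1)[THEN Ck_on_SucD]
  show ?case
  proof (rule Ck_on_SucI[OF assms(1)])
    fix x assume x: "x \<in> S"
    let ?f = "frechet_derivative f (at x)" and ?g = "frechet_derivative g (at (f x))"
    have f: "(f has_derivative ?f) (at x)"
      using Suc.prems x by (auto simp: frechet_derivative_works[symmetric])
    have g: "(g has_derivative ?g) (at (f x))"
      using Suc.prems x assms(5) by (auto simp: frechet_derivative_works[symmetric])
    have "?g (?f v) = (\<Sum>i\<in>Basis. (?f v \<bullet> i) *\<^sub>R ?g i)" for v
      by (subst euclidean_representation[symmetric, of "?f v"])
         (simp only: linear_sum[OF has_derivative_linear[OF g]] linear_cmul[OF has_derivative_linear[OF g]])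
    then show "((\<lambda>x. g (f x)) has_derivative (\<lambda>v. \<Sum>i\<in>Basis. (?f v \<bullet> i) *\<^sub>R ?g i)) (at x)"
      using diff_chain_at[OF f g] by (simp add: o_def)
  next
    fix v
    show "Ck_on k S (\<lambda>x. \<Sum>i\<in>Basis. (frechet_derivative f (at x) v \<bullet> i) *\<^sub>R frechet_derivative g (at (f x)) i)"
      using Suc.prems lower
      by (intro Ck_on_sum Ck_on_scaleR Ck_on_bounded_linear_compose[OF bounded_linear_inner_left] Suc.IH assms) auto
  qed
qed

text \<open>
  At a zero of the differentiable factor \<open>a\<close> the product rule needs only continuity of the
  other factor, since \<open>a y (b y - b x)\<close> is \<open>o(y - x)\<close>.
\<close>

lemma has_derivative_vanishing_scaleR:
  fixes a :: "'a::real_normed_vector \<Rightarrow> real"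
  assumes a: "(a has_derivative a') (at x)" and "a x = 0" and b: "continuous (at x) b"
  shows "((\<lambda>y. a y *\<^sub>R b y) has_derivative (\<lambda>v. a' v *\<^sub>R b x)) (at x)"
proof -
  have bl: "bounded_linear a'" and
    lim: "((\<lambda>y. norm (a y - a x - a' (y - x)) / norm (y - x)) \<longlongrightarrow> 0) (at x)"
    using a by (auto simp: has_derivative_iff_norm)
  obtain K where K: "\<And>v. norm (a' v) \<le> norm v * K" using bounded_linear.bounded[OF bl] by blast
  have "((\<lambda>y. a y *\<^sub>R (b y - b x)) has_derivative (\<lambda>v. 0)) (at x)"
    unfolding has_derivative_iff_norm
  proof (intro conjI bounded_linear_zero)
    have lim2: "((\<lambda>y. norm (b y - b x)) \<longlongrightarrow> 0) (at x)"
      using b by (simp add: continuous_at LIM_zero tendsto_norm_zero)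
    let ?q = "\<lambda>y. norm (a y - a x - a' (y - x)) / norm (y - x)"
    have "((\<lambda>y. (?q y + K) * norm (b y - b x)) \<longlongrightarrow> (0 + K) * 0) (at x)"
      by (intro tendsto_intros lim lim2)
    then have L: "((\<lambda>y. (?q y + K) * norm (b y - b x)) \<longlongrightarrow> 0) (at x)" by simp
    show "((\<lambda>y. norm (a y *\<^sub>R (b y - b x) - a x *\<^sub>R (b x - b x) - 0) / norm (y - x)) \<longlongrightarrow> 0) (at x)"
    proof (rule tendsto_sandwich[OF _ _ tendsto_const L])
      show "\<forall>\<^sub>F y in at x. norm (a y *\<^sub>R (b y - b x) - a x *\<^sub>R (b x - b x) - 0) / norm (y - x)
              \<le> (?q y + K) * norm (b y - b x)"
      proof (rule eventually_at_topological[THEN iffD2, OF exI[of _ UNIV]], intro conjI ballI impI)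
        fix y assume "y \<noteq> x"
        have "norm (a y) \<le> norm (a y - a x - a' (y - x)) + norm (y - x) * K"
          using K[of "y - x"] \<open>a x = 0\<close> by (simp add: norm_diff_ineq)
        then have "norm (a y) / norm (y - x) \<le> ?q y + K"
          using \<open>y \<noteq> x\<close> by (simp add: field_simps)
        from mult_right_mono[OF this norm_ge_zero[of "b y - b x"]]
        show "norm (a y *\<^sub>R (b y - b x) - a x *\<^sub>R (b x - b x) - 0) / norm (y - x)
              \<le> (?q y + K) * norm (b y - b x)" by simp
      qed auto
    qed auto
  qed
  from has_derivative_add[OF this has_derivative_scaleR_left[OF a, of "b x"]]
  show ?thesis by (simp add: algebra_simps)
qed

text \<open>
  With \<open>z = B x v - B x0 v\<close> one has \<open>A x z = v - A x (B x0 v)\<close>, which tends to zero, and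
  \<open>A x\<close> is bounded below uniformly for \<open>x\<close> near \<open>x0\<close> because \<open>A x0\<close> is.
\<close>

lemma continuous_inverse_family:
  fixes A B :: "'x::real_normed_vector \<Rightarrow> 'a::euclidean_space \<Rightarrow> 'a"
  assumes "open S" and lin: "\<And>x. x \<in> S \<Longrightarrow> linear (A x)"
    and AB: "\<And>x v. x \<in> S \<Longrightarrow> A x (B x v) = v" and BA: "\<And>x v. x \<in> S \<Longrightarrow> B x (A x v) = v"
    and cont: "\<And>v. continuous_on S (\<lambda>x. A x v)"
  shows "continuous_on S (\<lambda>x. B x v)"
proof (rule continuous_at_imp_continuous_on, rule ballI)
  fix x0 assume x0: "x0 \<in> S"
  have cA: "((\<lambda>x. A x w) \<longlongrightarrow> A x0 w) (at x0)" for w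
    using cont[of w] x0 \<open>open S\<close> by (simp add: continuous_on_eq_continuous_at continuous_at)
  have "inj (A x0)" by (metis BA x0 injI)
  then obtain c where c: "c > 0" "\<And>z. c * norm z \<le> norm (A x0 z)"
    using linear_inj_bounded_below_pos[OF lin[OF x0]] by blast
  have "((\<lambda>x. \<Sum>i\<in>Basis. norm (A x i - A x0 i)) \<longlongrightarrow> (\<Sum>i\<in>Basis. norm (A x0 i - A x0 i))) (at x0)"
    by (intro tendsto_intros cA)
  then have "\<forall>\<^sub>F x in at x0. (\<Sum>i\<in>Basis. norm (A x i - A x0 i)) < c / 2"
    using c(1) by (intro order_tendstoD) auto
  moreover have "\<forall>\<^sub>F x in at x0. x \<in> S"
    using \<open>open S\<close> x0 by (simp add: eventually_at_in_open')
  ultimately have ev: "\<forall>\<^sub>F x in at x0. norm (B x v - B x0 v) \<le> 2 / c * norm (v - A x (B x0 v))"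
  proof eventually_elim
    case (elim x)
    let ?z = "B x v - B x0 v"
    have Ax: "A x ?z = v - A x (B x0 v)"
      using elim by (simp add: linear_diff[OF lin] AB)
    have "A x ?z - A x0 ?z = (\<Sum>i\<in>Basis. (?z \<bullet> i) *\<^sub>R (A x i - A x0 i))"
    proof -
      have "A y ?z = (\<Sum>i\<in>Basis. (?z \<bullet> i) *\<^sub>R A y i)" if "y \<in> S" for y
        by (subst euclidean_representation[symmetric, of ?z])
           (simp only: linear_sum[OF lin[OF that]] linear_cmul[OF lin[OF that]])
      then show ?thesis
        using elim x0 by (simp add: sum_subtractf scaleR_diff_right)
    qed
    also have "norm \<dots> \<le> (\<Sum>i\<in>Basis. norm ?z * norm (A x i - A x0 i))"
      by (rule sum_norm_le) (auto intro!: mult_right_mono Basis_le_norm)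
    also have "\<dots> = norm ?z * (\<Sum>i\<in>Basis. norm (A x i - A x0 i))" by (simp add: sum_distrib_left)
    also have "\<dots> \<le> norm ?z * (c / 2)" using elim by (intro mult_left_mono) auto
    finally have "norm (A x ?z - A x0 ?z) \<le> norm ?z * (c / 2)" .
    moreover have "norm (A x0 ?z) \<le> norm (A x ?z) + norm (A x ?z - A x0 ?z)"
      by (metis norm_minus_commute norm_triangle_sub)
    ultimately have "c / 2 * norm ?z \<le> norm (A x ?z)"
      using c(2)[of ?z] by (simp add: field_simps)
    then show ?case using c(1) Ax by (simp add: field_simps)
  qed
  have "((\<lambda>x. 2 / c * norm (v - A x (B x0 v))) \<longlongrightarrow> 2 / c * norm (v - A x0 (B x0 v))) (at x0)"
    by (intro tendsto_intros cA)
  then have "((\<lambda>x. B x v - B x0 v) \<longlongrightarrow> 0) (at x0)"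
    using Lim_null_comparison[OF ev] AB[OF x0] by simp
  then show "isCont (\<lambda>x. B x v) x0"
    by (simp add: continuous_at LIM_zero_iff)
qed

text \<open>
  Inversion of matrices is smooth. From \<open>B y v = b0 + B y (v - A y b0)\<close> with \<open>b0 = B x v\<close>
  the factor \<open>v - A y b0\<close> vanishes at \<open>y = x\<close>, so continuity of \<open>B\<close> suffices for its
  differentiability, and the derivative \<open>w \<mapsto> - B x (A' w (B x v))\<close> is again built from \<open>A'\<close> and
  \<open>B\<close>. Written out in coordinates, this formula passes regularity from \<open>k\<close> to \<open>k + 1\<close>.
\<close>

lemma Ck_on_inverse_family:
  fixes A B :: "'x::real_normed_vector \<Rightarrow> 'a::euclidean_space \<Rightarrow> 'a" and v :: 'a
  assumes "open S" and lin: "\<And>x. x \<in> S \<Longrightarrow> linear (A x)"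
    and AB: "\<And>x v. x \<in> S \<Longrightarrow> A x (B x v) = v" and BA: "\<And>x v. x \<in> S \<Longrightarrow> B x (A x v) = v"
    and Ck: "\<And>v. Ck_on k S (\<lambda>x. A x v)"
  shows "Ck_on k S (\<lambda>x. B x v)"
  using Ck
proof (induction k arbitrary: v)
  case 0
  then show ?case
    using continuous_inverse_family[OF assms(1) lin AB BA, where v=v] by simp
next
  case (Suc k)
  have linB: "linear (B x)" if "x \<in> S" for x
  proof (rule linearI)
    fix a b :: 'a and c :: real
    have "A x (B x a + B x b) = a + b" "A x (c *\<^sub>R B x a) = c *\<^sub>R a"
      by (simp_all add: linear_add[OF lin[OF that]] linear_cmul[OF lin[OF that]] AB[OF that])
    then show "B x (a + b) = B x a + B x b" "B x (c *\<^sub>R a) = c *\<^sub>R B x a"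
      using BA[OF that] by metis+
  qed
  have expand: "L w = (\<Sum>i\<in>Basis. (w \<bullet> i) *\<^sub>R L i)" if "linear L" for L :: "'a \<Rightarrow> 'a" and w
    by (subst euclidean_representation[symmetric, of w]) (simp only: linear_sum[OF that] linear_cmul[OF that])
  have lower: "Ck_on k S (\<lambda>x. B x w)" for w
    by (rule Suc.IH) (rule Ck_on_SucD[OF Suc.prems])
  have contB: "continuous (at x) (\<lambda>x. B x w)" if "x \<in> S" for x w
  proof -
    have "continuous_on S (\<lambda>x. B x w)"
      by (rule continuous_inverse_family[OF assms(1) lin AB BA Ck_on_Suc_continuous_on[OF Suc.prems]])
    then show ?thesis using assms(1) that by (simp add: continuous_on_eq_continuous_at)
  qed
  let ?A' = "\<lambda>i x w. frechet_derivative (\<lambda>x. A x i) (at x) w"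
  let ?r' = "\<lambda>x w. \<Sum>i\<in>Basis. (- (B x v \<bullet> i)) *\<^sub>R ?A' i x w"
  show ?case
  proof (rule Ck_on_SucI[OF assms(1)])
    fix x assume x: "x \<in> S"
    define b0 where "b0 = B x v"
    let ?r = "\<lambda>y. v + (\<Sum>i\<in>Basis. (- (b0 \<bullet> i)) *\<^sub>R A y i)"
    have r: "?r y = v - A y b0" if "y \<in> S" for y
      by (simp add: expand[OF lin[OF that], of b0] sum_negf)
    have rx: "?r x = 0" by (simp only: r[OF x]) (simp add: b0_def AB[OF x])
    have A': "((\<lambda>y. A y i) has_derivative ?A' i x) (at x)" for i
      using Suc.prems[of i] x by (simp add: frechet_derivative_works[symmetric])
    have "((\<lambda>y. ?r y) has_derivative (\<lambda>w. 0 + (\<Sum>i\<in>Basis. (- (b0 \<bullet> i)) *\<^sub>R ?A' i x w))) (at x)"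
      by (intro has_derivative_add has_derivative_const has_derivative_sum has_derivative_scaleR_right A')
    then have r': "(?r has_derivative ?r' x) (at x)" by (simp add: b0_def)
    have "((\<lambda>y. b0 + (\<Sum>j\<in>Basis. (?r y \<bullet> j) *\<^sub>R B y j)) has_derivative
       (\<lambda>w. 0 + (\<Sum>j\<in>Basis. (?r' x w \<bullet> j) *\<^sub>R B x j))) (at x)"
      by (intro has_derivative_add has_derivative_const has_derivative_sum
          has_derivative_vanishing_scaleR has_derivative_inner_left r' contB x)
         (simp only: rx inner_zero_left)
    then have "((\<lambda>y. b0 + (\<Sum>j\<in>Basis. (?r y \<bullet> j) *\<^sub>R B y j)) has_derivative
       (\<lambda>w. \<Sum>j\<in>Basis. (?r' x w \<bullet> j) *\<^sub>R B x j)) (at x)" by simp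
    then show "((\<lambda>y. B y v) has_derivative
       (\<lambda>w. \<Sum>j\<in>Basis. (?r' x w \<bullet> j) *\<^sub>R B x j)) (at x)"
    proof (rule has_derivative_transform_within_open[OF _ assms(1) x])
      fix y assume y: "y \<in> S"
      have "(\<Sum>j\<in>Basis. (?r y \<bullet> j) *\<^sub>R B y j) = B y (?r y)"
        using expand[OF linB[OF y]] by metis
      also have "\<dots> = B y v - b0" by (simp only: r[OF y] linear_diff[OF linB[OF y]] BA[OF y])
      finally show "b0 + (\<Sum>j\<in>Basis. (?r y \<bullet> j) *\<^sub>R B y j) = B y v" by simp
    qed
  next
    fix w
    have "Ck_on k S (\<lambda>x. ?A' i x w)" for i using Suc.prems[of i] by simp
    then show "Ck_on k S (\<lambda>x. \<Sum>j\<in>Basis. (?r' x w \<bullet> j) *\<^sub>R B x j)"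
      by (intro Ck_on_sum Ck_on_scaleR Ck_on_bounded_linear_compose[OF bounded_linear_inner_left]
          Ck_on_bounded_linear_compose[OF bounded_linear_minus[OF bounded_linear_ident]] lower assms)
  qed
qed

section \<open>Smooth maps and the smooth inverse function theorem\<close>

lemma smooth_on_Ck_on: "smooth_on S f \<Longrightarrow> Ck_on k S f"
  by (simp add: smooth_on_def)

lemma smooth_on_open: "smooth_on S f \<Longrightarrow> open S"
  by (simp add: smooth_on_def)

lemma smooth_on_continuous_on: "smooth_on S f \<Longrightarrow> continuous_on S f"
  unfolding smooth_on_def using Ck_on.simps(1) by blast

lemma smooth_on_has_derivative:
  assumes "smooth_on S f" "x \<in> S"
  shows "(f has_derivative frechet_derivative f (at x)) (at x)"
  using smooth_on_Ck_on[OF assms(1), of "Suc 0"] assms(2)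
  by (simp add: frechet_derivative_works[symmetric])

lemma smooth_on_subset: "smooth_on S f \<Longrightarrow> open T \<Longrightarrow> T \<subseteq> S \<Longrightarrow> smooth_on T f"
  by (auto simp: smooth_on_def intro: Ck_on_subset)

lemma smooth_on_bounded_linear: "bounded_linear L \<Longrightarrow> open S \<Longrightarrow> smooth_on S L"
  by (simp add: smooth_on_def Ck_on_bounded_linear)

lemma smooth_on_const: "open S \<Longrightarrow> smooth_on S (\<lambda>x. c)"
  by (simp add: smooth_on_def Ck_on_const)

lemma smooth_on_bounded_linear_compose:
  "bounded_linear L \<Longrightarrow> smooth_on S f \<Longrightarrow> smooth_on S (\<lambda>x. L (f x))"
  by (simp add: smooth_on_def Ck_on_bounded_linear_compose)

lemma smooth_on_add: "smooth_on S f \<Longrightarrow> smooth_on S g \<Longrightarrow> smooth_on S (\<lambda>x. f x + g x)"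
  by (simp add: smooth_on_def Ck_on_add)

lemma smooth_on_compose:
  fixes f :: "'a::real_normed_vector \<Rightarrow> 'b::euclidean_space"
  shows "smooth_on S f \<Longrightarrow> smooth_on T g \<Longrightarrow> f ` S \<subseteq> T \<Longrightarrow> smooth_on S (\<lambda>x. g (f x))"
  unfolding smooth_on_def using Ck_on_compose by blast

lemma smooth_on_Pair:
  assumes "smooth_on S f" "smooth_on S g"
  shows "smooth_on S (\<lambda>x. (f x, g x))"
proof -
  have 1: "bounded_linear (\<lambda>x. (x, 0))" and 2: "bounded_linear (\<lambda>x. (0, x))"
    by (intro bounded_linear_Pair bounded_linear_ident bounded_linear_zero)+
  show ?thesis
    using smooth_on_add[OF smooth_on_bounded_linear_compose[OF 1 assms(1)]
        smooth_on_bounded_linear_compose[OF 2 assms(2)]] by simp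
qed

text \<open>
  Germs of smooth maps compose; the radius has to shrink so that the inner map lands in the
  domain of the outer one.
\<close>

lemma smooth_near_compose:
  fixes f :: "'a::real_normed_vector \<Rightarrow> 'b::euclidean_space"
  assumes "smooth_on (ball c d) f" "d > 0" "smooth_on T g" "f c \<in> T"
  shows "\<exists>d'>0. smooth_on (ball c d') (\<lambda>x. g (f x))"
proof -
  have "open (ball c d \<inter> f -` T)"
    by (rule continuous_open_preimage[OF smooth_on_continuous_on[OF assms(1)] open_ball smooth_on_open[OF assms(3)]])
  moreover have "c \<in> ball c d \<inter> f -` T" using assms(2,4) by simp
  ultimately obtain d' where d': "d' > 0" "ball c d' \<subseteq> ball c d \<inter> f -` T"
    using openE by blast
  have "smooth_on (ball c d') f"
    using smooth_on_subset[OF assms(1)] d' by simp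
  then have "smooth_on (ball c d') (\<lambda>x. g (f x))"
    using smooth_on_compose[OF _ assms(3)] d' by blast
  then show ?thesis using d' by blast
qed

text \<open>
  The \<open>C\<^sup>1\<close> inverse function theorem gives \<open>g' y = (f' (g y))\<inverse>\<close>. If \<open>g\<close> is \<open>C\<^sup>k\<close>, the
  right-hand side is \<open>C\<^sup>k\<close> by the smoothness of inversion, hence \<open>g\<close> is \<open>C\<^sup>k\<^sup>+\<^sup>1\<close>.
\<close>

theorem smooth_inverse_function:
  fixes f :: "'a::euclidean_space \<Rightarrow> 'a"
  assumes smooth: "smooth_on S f" and x0: "x0 \<in> S" and inj: "inj (frechet_derivative f (at x0))"
  obtains U V g where "open U" "x0 \<in> U" "U \<subseteq> S" "open V" "f x0 \<in> V"
    "homeomorphism U V f g" "smooth_on V g"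
    "\<And>y v. y \<in> V \<Longrightarrow> frechet_derivative f (at (g y)) (frechet_derivative g (at y) v) = v"
proof -
  let ?D = "\<lambda>x. frechet_derivative f (at x)"
  define f' where "f' x = Blinfun (?D x)" for x
  have der: "(f has_derivative ?D x) (at x)" if "x \<in> S" for x
    using smooth_on_has_derivative[OF smooth that] .
  have f': "blinfun_apply (f' x) = ?D x" if "x \<in> S" for x
    unfolding f'_def using der[OF that] by (simp add: bounded_linear_Blinfun_apply has_derivative_bounded_linear)
  have CkD: "Ck_on k S (\<lambda>x. ?D x v)" for k v
    using smooth_on_Ck_on[OF smooth, of "Suc k"] by simp
  have "continuous_on S (\<lambda>x. f' x i)" for i
  proof -
    have "continuous_on S (\<lambda>x. ?D x i)" using CkD[of 0] by simp
    then show ?thesis by (rule continuous_on_eq) (simp add: f')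
  qed
  then have cont: "continuous_on S f'" by (intro continuous_on_blinfun_componentwise)
  obtain l where l: "linear l" "l \<circ> ?D x0 = id"
    using linear_injective_left_inverse[OF has_derivative_linear[OF der[OF x0]] inj] by blast
  have left: "Blinfun l o\<^sub>L f' x0 = id_blinfun"
    by (rule blinfun_eqI)
       (use l in \<open>simp add: f'[OF x0] bounded_linear_Blinfun_apply linear_conv_bounded_linear fun_eq_iff\<close>)
  have derS: "(f has_derivative blinfun_apply (f' x)) (at x)" if "x \<in> S" for x
    using der[OF that] f'[OF that] by simp
  obtain U V g g' where UV: "open U" "U \<subseteq> S" "x0 \<in> U" "open V" "f x0 \<in> V" "homeomorphism U V f g"
    and g': "\<And>y. y \<in> V \<Longrightarrow> (g has_derivative (g' y)) (at y)"
    and inv: "\<And>y. y \<in> V \<Longrightarrow> g' y = inv (blinfun_apply (f'(g y)))"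
    and bij: "\<And>y. y \<in> V \<Longrightarrow> bij (blinfun_apply (f'(g y)))"
    by (rule inverse_function_theorem[OF smooth_on_open[OF smooth] derS cont x0 left], assumption) (rule that)
  have gS: "g y \<in> S" if "y \<in> V" for y
    using UV(2,6) that by (auto simp: homeomorphism_def)
  have right_inv: "?D (g y) (g' y v) = v" and left_inv: "g' y (?D (g y) v) = v" if "y \<in> V" for y v
    using bij[OF that] by (simp_all add: inv[OF that] f'[OF gS[OF that]] bij_is_surj surj_f_inv_f bij_is_inj)
  have Ckg: "Ck_on k V g" for k
  proof (induction k)
    case 0
    then show ?case using UV(6) by (simp add: homeomorphism_def)
  next
    case (Suc k)
    show ?case
    proof (rule Ck_on_SucI[OF UV(4) g'])
      fix v
      show "Ck_on k V (\<lambda>y. g' y v)"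
      proof (rule Ck_on_inverse_family[OF UV(4)])
        show "linear (?D (g y))" if "y \<in> V" for y
          using has_derivative_linear[OF der[OF gS[OF that]]] .
        show "Ck_on k V (\<lambda>y. ?D (g y) v)" for v
          by (rule Ck_on_compose[OF UV(4) smooth_on_open[OF smooth] Suc CkD]) (use gS in auto)
      qed (use right_inv left_inv in auto)
    qed
  qed
  show ?thesis
  proof (rule that[OF UV(1,3,2,4,5,6)])
    show "smooth_on V g" using UV(4) Ckg by (simp add: smooth_on_def)
    show "?D (g y) (frechet_derivative g (at y) v) = v" if "y \<in> V" for y v
      using right_inv[OF that] frechet_derivative_at[OF g'[OF that]] by simp
  qed
qed

section \<open>Jacobian blocks as linear maps\<close>

text \<open>
  If the only nonzero columns are those in \<open>C\<close> and the rank is \<open>card C\<close>, these columns are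
  linearly independent: a kernel vector with a nonzero entry at \<open>c\<close> would express column \<open>c\<close>
  through the others and make the rank smaller than \<open>card C\<close>.
\<close>

lemma full_column_rank_kernel:
  fixes M :: "real^'c^'r"
  assumes outside: "\<And>c. c \<notin> C \<Longrightarrow> column c M = 0" and rank: "rank M = card C"
    and ker: "M *v v = 0" and supp: "\<And>c. c \<notin> C \<Longrightarrow> v $ c = 0"
  shows "v = 0"
proof (rule ccontr)
  assume "v \<noteq> 0"
  then obtain c where c: "v $ c \<noteq> 0" "c \<in> C" using supp by (metis vec_eq_iff zero_index)
  let ?W = "(\<lambda>c. column c M) ` (C - {c})"
  have "0 = (\<Sum>b\<in>UNIV. v $ b *\<^sub>R column b M)"
    using ker by (simp add: matrix_mult_sum scalar_mult_eq_scaleR)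
  also have "\<dots> = v $ c *\<^sub>R column c M + (\<Sum>b\<in>UNIV - {c}. v $ b *\<^sub>R column b M)"
    by (simp add: sum.remove)
  finally have "v $ c *\<^sub>R column c M = - (\<Sum>b\<in>UNIV - {c}. v $ b *\<^sub>R column b M)"
    by (simp add: eq_neg_iff_add_eq_0)
  moreover have "v $ b *\<^sub>R column b M \<in> span ?W" if "b \<noteq> c" for b
  proof (cases "b \<in> C")
    case True
    then have "column b M \<in> ?W" using that by blast
    then show ?thesis by (intro span_scale span_base)
  qed (simp add: outside span_zero)
  ultimately have "v $ c *\<^sub>R column c M \<in> span ?W"
    by (auto intro!: span_neg span_sum)
  then have "column c M \<in> span ?W"
    using c(1) by (metis span_scale[of _ _ "inverse (v $ c)"] scaleR_scaleR left_inverse scaleR_one)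
  then have "column b M \<in> span ?W" for b
    using outside[of b] by (cases "b \<in> C - {c}"; cases "b = c") (auto intro!: span_base[OF imageI] simp: span_zero)
  then have "columns M \<subseteq> span ?W" by (auto simp: columns_def)
  then have "dim (columns M) \<le> card ?W" by (intro dim_le_card) auto
  also have "\<dots> \<le> card (C - {c})" by (simp add: card_image_le)
  also have "\<dots> < card C" using c(2) by (intro card_Diff1_less) auto
  finally show False using rank by (simp add: column_rank_def)
qed

lemma jacobian_block_mult:
  fixes f :: "(real^'n::finite) \<times> (real^'m::finite) \<Rightarrow> real^'n"
  assumes "linear (frechet_derivative f (at z))"
  shows "(jacobian_block f z R A B *v c) $ i =
    (if i \<in> R then frechet_derivative f (at z)
       ((\<chi> l. if l \<in> A then c $ Inl l else 0), (\<chi> j. if j \<in> B then c $ Inr j else 0)) $ i else 0)"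
proof (cases "i \<in> R")
  case True
  let ?D = "frechet_derivative f (at z)"
  define a :: "real^'n" where "a = (\<chi> l. if l \<in> A then c $ Inl l else 0)"
  define b :: "real^'m" where "b = (\<chi> j. if j \<in> B then c $ Inr j else 0)"
  have "a = (\<Sum>l\<in>UNIV. a $ l *\<^sub>R axis l 1)" "b = (\<Sum>j\<in>UNIV. b $ j *\<^sub>R axis j 1)"
    by (simp_all only: scalar_mult_eq_scaleR[symmetric] basis_expansion)
  then have "(a, b) = (\<Sum>l\<in>UNIV. a $ l *\<^sub>R (axis l 1, 0)) + (\<Sum>j\<in>UNIV. b $ j *\<^sub>R (0, axis j 1))"
    by (simp add: prod_eq_iff fst_sum snd_sum)
  then have "?D (a, b) = (\<Sum>l\<in>UNIV. a $ l *\<^sub>R ?D (axis l 1, 0)) + (\<Sum>j\<in>UNIV. b $ j *\<^sub>R ?D (0, axis j 1))"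
    by (simp only: linear_add[OF assms] linear_sum[OF assms] linear_cmul[OF assms])
  moreover have "(jacobian_block f z R A B *v c) $ i =
     (\<Sum>l\<in>UNIV. a $ l * ?D (axis l 1, 0) $ i) + (\<Sum>j\<in>UNIV. b $ j * ?D (0, axis j 1) $ i)"
  proof -
    have "(jacobian_block f z R A B *v c) $ i =
      (\<Sum>l\<in>UNIV. jacobian_block f z R A B $ i $ Inl l * c $ Inl l) +
      (\<Sum>j\<in>UNIV. jacobian_block f z R A B $ i $ Inr j * c $ Inr j)"
      unfolding matrix_vector_mult_def vec_lambda_beta UNIV_Plus_UNIV[symmetric]
      by (subst sum.Plus) (auto simp: sum.reindex)
    also have "\<dots> = (\<Sum>l\<in>UNIV. a $ l * ?D (axis l 1, 0) $ i) + (\<Sum>j\<in>UNIV. b $ j * ?D (0, axis j 1) $ i)"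
      using True by (intro arg_cong2[of _ _ _ _ "(+)"] sum.cong) (auto simp: jacobian_block_def a_def b_def)
    finally show ?thesis .
  qed
  ultimately show ?thesis using True by (simp add: a_def[symmetric] b_def[symmetric])
qed (simp add: matrix_vector_mult_def jacobian_block_def)

section \<open>State representations of the implicit Euler discretization\<close>

lemma open_contains_box:
  assumes "open S" "(a, b) \<in> S"
  obtains r where "r > 0" "ball a r \<times> ball b r \<subseteq> S"
proof -
  obtain A B where AB: "open A" "open B" "a \<in> A" "b \<in> B" "A \<times> B \<subseteq> S"
    using open_prod_elim[OF assms] by (metis mem_Sigma_iff)
  obtain r1 r2 where "r1 > 0" "ball a r1 \<subseteq> A" "r2 > 0" "ball b r2 \<subseteq> B"
    using openE[OF AB(1,3)] openE[OF AB(2,4)] by metis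
  then have "min r1 r2 > 0" "ball a (min r1 r2) \<times> ball b (min r1 r2) \<subseteq> S"
    using AB(5) by (auto simp: subset_iff)
  then show ?thesis by (rule that)
qed

lemma state_representation_equilibrium:
  assumes "f (xs, us) = 0" "state_representation f T xs us g"
  shows "g (xs, us) = xs"
proof -
  obtain W V where "(xs, us) \<in> W" "xs \<in> V"
    and "\<forall>(x, u)\<in>W. \<forall>x'\<in>V. x' = x + T *\<^sub>R f (x', u) \<longleftrightarrow> x' = g (x, u)"
    using assms(2) unfolding state_representation_def by blast
  then have "xs = xs + T *\<^sub>R f (xs, us) \<longleftrightarrow> xs = g (xs, us)" by blast
  then show ?thesis using assms(1) by simp
qed

text \<open>
  On a neighbourhood of the equilibrium \<open>x = g (x, u) - T f (g (x, u), u)\<close>, so that \<open>(x, u)\<close> can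
  be recovered from \<open>(g (x, u), u)\<close>. Hence \<open>v \<mapsto> (Dg v, snd v)\<close> is injective, by dimension also
  surjective, and so is its first component \<open>Dg\<close>.
\<close>

lemma state_representation_submersive:
  fixes f :: "(real^'n::finite) \<times> (real^'m::finite) \<Rightarrow> real^'n"
  assumes smooth: "smooth_on D f" and eq: "(xs, us) \<in> D" "f (xs, us) = 0"
    and rep: "state_representation f T xs us g"
  shows "submersive_near g (xs, us)"
proof -
  obtain W V where W: "open W" "(xs, us) \<in> W" "open V" "xs \<in> V" "smooth_on W g"
    and rep': "\<And>x u x'. (x, u) \<in> W \<Longrightarrow> x' \<in> V \<Longrightarrow> x' = x + T *\<^sub>R f (x', u) \<longleftrightarrow> x' = g (x, u)"
    using rep unfolding state_representation_def by blast
  define W' where "W' = W \<inter> (\<lambda>z. (g z, snd z)) -` (D \<inter> V \<times> UNIV)"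
  have "open W'"
    unfolding W'_def
    by (intro continuous_open_preimage continuous_intros smooth_on_continuous_on[OF W(5)]
        smooth_on_open[OF smooth] open_Int open_Times open_UNIV W)
  have "(xs, us) \<in> W'"
    using state_representation_equilibrium[OF eq(2) rep] eq W by (simp add: W'_def)
  have smooth': "smooth_on W' g"
    by (rule smooth_on_subset[OF W(5) \<open>open W'\<close>]) (auto simp: W'_def)
  have "rank (jacobian_block g z UNIV UNIV UNIV) = CARD('n)" if z: "z \<in> W'" for z
  proof -
    let ?G = "frechet_derivative g (at z)" and ?F = "frechet_derivative f (at (g z, snd z))"
    have G: "(g has_derivative ?G) (at z)" using smooth_on_has_derivative[OF smooth' z] .
    have N: "((\<lambda>z. (g z, snd z)) has_derivative (\<lambda>v. (?G v, snd v))) (at z)"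
      by (intro has_derivative_Pair has_derivative_snd has_derivative_ident G)
    have F: "(f has_derivative ?F) (at (g z, snd z))"
      using smooth_on_has_derivative[OF smooth] z by (simp add: W'_def)
    have "((\<lambda>z. g z - T *\<^sub>R f (g z, snd z)) has_derivative (\<lambda>v. ?G v - T *\<^sub>R ?F (?G v, snd v))) (at z)"
      using diff_chain_at[OF N F]
      by (intro has_derivative_diff has_derivative_scaleR_right G) (simp add: o_def)
    moreover have "g y - T *\<^sub>R f (g y, snd y) = fst y" if "y \<in> W'" for y
      using rep'[of "fst y" "snd y" "g y"] that by (simp add: W'_def algebra_simps)
    ultimately have "(fst has_derivative (\<lambda>v. ?G v - T *\<^sub>R ?F (?G v, snd v))) (at z)"
      using has_derivative_transform_within_open[OF _ \<open>open W'\<close> z] by blast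
    moreover have "(fst has_derivative fst) (at z)"
      by (rule bounded_linear_imp_has_derivative[OF bounded_linear_fst])
    ultimately have "(\<lambda>v. ?G v - T *\<^sub>R ?F (?G v, snd v)) = fst" by (rule has_derivative_unique)
    then have fst_eq: "?G v - T *\<^sub>R ?F (?G v, snd v) = fst v" for v by (rule fun_cong)
    have linG: "linear ?G" and linN: "linear (\<lambda>v. (?G v, snd v))" and linF: "linear ?F"
      using G N F by (simp_all add: has_derivative_linear)
    have "inj (\<lambda>v. (?G v, snd v))"
      unfolding linear_injective_0[OF linN]
    proof (intro allI impI)
      fix v assume "(?G v, snd v) = 0"
      then show "v = 0"
        using fst_eq[of v] linear_0[OF linF] by (simp add: prod_eq_iff zero_prod_def)
    qed
    then have surjN: "surj (\<lambda>v. (?G v, snd v))" by (rule linear_injective_imp_surjective[OF linN]) simp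
    have "\<exists>c. jacobian_block g z UNIV UNIV UNIV *v c = y" for y
    proof -
      obtain v where v: "(y, 0) = (?G v, snd v)" using surjD[OF surjN] by blast
      have "jacobian_block g z UNIV UNIV UNIV *v (\<chi> c. case c of Inl l \<Rightarrow> fst v $ l | Inr j \<Rightarrow> snd v $ j)
          = ?G (fst v, snd v)"
        by (simp add: vec_eq_iff jacobian_block_mult[OF linG] del: prod.collapse)
      then show ?thesis using v by auto
    qed
    then show ?thesis unfolding full_rank_surjective surj_def by metis
  qed
  then show ?thesis
    unfolding submersive_near_def using \<open>(xs, us) \<in> W'\<close> smooth' by blast
qed

text \<open>
  For small \<open>T\<close> the map \<open>(x', u) \<mapsto> (x' - T f (x', u), u)\<close> is a small perturbation of the
  identity, hence a local diffeomorphism. As it preserves \<open>u\<close>, the first component of its inverse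
  gives \<open>x'\<close> as a function of \<open>(x, u)\<close>.
\<close>

lemma eventually_state_representation:
  fixes f :: "(real^'n::finite) \<times> (real^'m::finite) \<Rightarrow> real^'n"
  assumes smooth: "smooth_on D f" and eq: "(xs, us) \<in> D" "f (xs, us) = 0"
  shows "\<forall>\<^sub>F T in at_right (0::real). \<exists>g. state_representation f T xs us g"
proof -
  let ?F = "frechet_derivative f (at (xs, us))"
  have F: "(f has_derivative ?F) (at (xs, us))" using smooth_on_has_derivative[OF smooth eq(1)] .
  obtain B where B: "B > 0" "\<And>v. norm (?F v) \<le> B * norm v"
    using linear_bounded_pos[OF has_derivative_linear[OF F]] by blast
  show ?thesis
  proof (rule eventually_at_rightI)
    show "0 < 1 / B" using B by simp
    fix T assume T: "T \<in> {0<..<1 / B}"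
    define \<psi> where "\<psi> w = (fst w - T *\<^sub>R f w, snd w)" for w
    have smooth\<psi>: "smooth_on D \<psi>"
      unfolding \<psi>_def diff_conv_add_uminus scaleR_minus_left[symmetric]
      by (intro smooth_on_Pair smooth_on_add smooth_on_bounded_linear bounded_linear_fst bounded_linear_snd
          smooth_on_open[OF smooth] smooth_on_bounded_linear_compose[OF bounded_linear_scaleR_right] smooth)
    have D\<psi>: "(\<psi> has_derivative (\<lambda>v. (fst v - T *\<^sub>R ?F v, snd v))) (at (xs, us))"
      unfolding \<psi>_def
      by (intro has_derivative_Pair has_derivative_diff has_derivative_fst has_derivative_snd
          has_derivative_ident has_derivative_scaleR_right F)
    have "inj (\<lambda>v. (fst v - T *\<^sub>R ?F v, snd v))"
      unfolding linear_injective_0[OF has_derivative_linear[OF D\<psi>]]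
    proof (intro allI impI)
      fix v :: "(real^'n) \<times> (real^'m)" assume "(fst v - T *\<^sub>R ?F v, snd v) = 0"
      then have v: "fst v = T *\<^sub>R ?F v" "snd v = 0" by (simp_all add: zero_prod_def)
      then have "norm v = norm (fst v)" by (simp add: norm_prod_def)
      also have "\<dots> = T * norm (?F v)" using T by (subst v(1)) simp
      also have "\<dots> \<le> T * (B * norm v)" using T B(2) by (intro mult_left_mono) auto
      finally have "(1 - T * B) * norm v \<le> 0" by (simp add: algebra_simps)
      moreover have "T * B < 1" using T B(1) by (simp add: field_simps)
      ultimately show "v = 0"
        by (simp add: mult_le_0_iff)
    qed
    then have "inj (frechet_derivative \<psi> (at (xs, us)))"
      using frechet_derivative_at[OF D\<psi>] by simp
    then obtain U V h where UV: "open U" "(xs, us) \<in> U" "open V" "\<psi> (xs, us) \<in> V"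
      and hom: "homeomorphism U V \<psi> h" and smooth_h: "smooth_on V h"
      using smooth_inverse_function[OF smooth\<psi> eq(1)] by metis
    obtain r where r: "r > 0" "ball xs r \<times> ball us r \<subseteq> U"
      using open_contains_box[OF UV(1,2)] .
    define W where "W = V \<inter> h -` (ball xs r \<times> ball us r)"
    have W: "open W" unfolding W_def
      by (intro continuous_open_preimage smooth_on_continuous_on[OF smooth_h] UV open_Times open_ball)
    have \<psi>h: "\<psi> (h v) = v" if "v \<in> V" for v using hom that by (simp add: homeomorphism_def)
    have h\<psi>: "h (\<psi> w) = w" if "w \<in> U" for w using hom that by (simp add: homeomorphism_def)
    have "state_representation f T xs us (\<lambda>z. fst (h z))"
      unfolding state_representation_def
    proof (intro exI conjI)
      show "(xs, us) \<in> W"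
        using UV(4) h\<psi>[OF UV(2)] r(1) by (simp add: W_def \<psi>_def eq)
      show "smooth_on W (\<lambda>z. fst (h z))"
        using smooth_on_subset[OF smooth_on_bounded_linear_compose[OF bounded_linear_fst smooth_h] W]
        by (simp add: W_def)
      show "open (ball xs r)" "xs \<in> ball xs r" using r by auto
      show "\<forall>(x, u)\<in>W. \<forall>x'\<in>ball xs r. (x' = x + T *\<^sub>R f (x', u)) = (x' = fst (h (x, u)))"
      proof clarify
        fix x u x' assume z: "(x, u) \<in> W" and x': "x' \<in> ball xs r"
        obtain x2 u2 where h: "h (x, u) = (x2, u2)" by fastforce
        have \<psi>: "x2 - T *\<^sub>R f (x2, u2) = x" "u2 = u" "u2 \<in> ball us r"
          using \<psi>h[of "(x, u)"] z h by (auto simp: W_def \<psi>_def)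
        show "(x' = x + T *\<^sub>R f (x', u)) = (x' = fst (h (x, u)))"
        proof
          assume "x' = x + T *\<^sub>R f (x', u)"
          then have "\<psi> (x', u) = (x, u)" by (simp add: \<psi>_def algebra_simps)
          moreover have "(x', u) \<in> U" using r x' \<psi> by auto
          ultimately show "x' = fst (h (x, u))" using h\<psi> by fastforce
        next
          assume "x' = fst (h (x, u))"
          then show "x' = x + T *\<^sub>R f (x', u)" using h \<psi> by (auto simp: algebra_simps)
        qed
      qed
    qed (rule W)
    then show "\<exists>g. state_representation f T xs us g" by blast
  qed
qed

lemma card_eq_sum_card_fibres:
  assumes "finite A" "finite K" "g ` A \<subseteq> K"
  shows "card A = (\<Sum>k\<in>K. card {a \<in> A. g a = k})"
  using sum.group[OF assms, of "\<lambda>_. 1::nat"] by simp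

text \<open>
  The projections through which a window map factors.
\<close>

lemma bounded_linear_apply_bcontfun:
  "bounded_linear (\<lambda>s :: 'a::topological_space \<Rightarrow>\<^sub>C 'b::real_normed_vector. apply_bcontfun s k)"
  by (rule bounded_linear_intro[of _ 1]) (simp_all add: norm_bounded)

section \<open>Linearization of a structurally flat triangular system\<close>

locale structurally_flat_system =
  fixes f :: "(real^'n::finite) \<times> (real^'m::finite) \<Rightarrow> real^'n"
    and D :: "((real^'n) \<times> (real^'m)) set"
    and p :: nat and xb :: "'n \<Rightarrow> nat" and H :: "'n set" and ub :: "'m \<Rightarrow> nat"
  assumes smooth: "smooth_on D f"
    and triangular: "structurally_flat_triangular_on D p xb H ub f"
begin

lemma xb_range: "range xb = {1..p}"
  and H_block: "i \<in> H \<Longrightarrow> xb i < p" and ub_less: "ub j < p"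
  using triangular by (auto simp: structurally_flat_triangular_on_def)

lemma xb_pos: "1 \<le> xb i" and xb_le: "xb i \<le> p"
  using xb_range by (auto simp: set_eq_iff image_iff)

lemma block_card:
  "k < p \<Longrightarrow> card {i. xb i = k + 1} = card {l \<in> H. xb l = k} + card {j. ub j = k}"
  and block_rank:
  "k < p \<Longrightarrow> z \<in> D \<Longrightarrow>
     rank (jacobian_block f z {i. xb i = k + 1} {l \<in> H. xb l = k} {j. ub j = k}) = card {i. xb i = k + 1}"
  using triangular by (auto simp: structurally_flat_triangular_on_def)

lemma f_component_cong:
  assumes "(x, u) \<in> D" "(x', u') \<in> D"
    and "\<And>l. xb i - 1 \<le> xb l \<Longrightarrow> x $ l = x' $ l" "\<And>j. xb i - 1 \<le> ub j \<Longrightarrow> u $ j = u' $ j"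
  shows "f (x, u) $ i = f (x', u') $ i"
  using triangular assms unfolding structurally_flat_triangular_on_def by blast

text \<open>
  Adding up the dimension conditions over all blocks gives \<open>n = card H + m\<close>: the number of
  state components outside \<open>H\<close>, which will form the flat output, is the number of inputs.
\<close>

lemma ex_output_enumeration: "\<exists>\<sigma>::'m \<Rightarrow> 'n. bij_betw \<sigma> UNIV (- H)"
proof -
  have "card (UNIV :: 'n set) = (\<Sum>k<p. card {i. xb i = k + 1})"
  proof -
    have "xb i - 1 < p" for i using xb_pos[of i] xb_le[of i] by linarith
    then have "card (UNIV :: 'n set) = (\<Sum>k<p. card {i \<in> UNIV. xb i - 1 = k})"
      by (intro card_eq_sum_card_fibres) auto
    moreover have "{i \<in> UNIV. xb i - 1 = k} = {i. xb i = k + 1}" for k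
      using xb_pos by (auto simp: le_diff_conv Suc_leI) (metis Suc_pred' One_nat_def less_eq_Suc_le)
    ultimately show ?thesis by simp
  qed
  also have "\<dots> = (\<Sum>k<p. card {l \<in> H. xb l = k}) + (\<Sum>k<p. card {j \<in> UNIV. ub j = k})"
    using block_card by (simp add: sum.distrib)
  also have "\<dots> = card H + card (UNIV :: 'm set)"
    using H_block ub_less by (subst (1 2) card_eq_sum_card_fibres[symmetric]) auto
  finally have "card (UNIV :: 'm set) = card (- H)"
    by (simp add: Compl_eq_Diff_UNIV card_Diff_subset)
  then show ?thesis by (intro finite_same_card_bij) auto
qed

lemma f_has_derivative: "z \<in> D \<Longrightarrow> (f has_derivative frechet_derivative f (at z)) (at z)"
  using smooth_on_has_derivative[OF smooth] .

text \<open>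
  Component \<open>i\<close> of \<open>f\<close> does not change along a line inside \<open>D\<close> whose direction has no components
  in the blocks that it depends on.
\<close>

lemma derivative_triangular:
  assumes z: "z \<in> D"
    and "\<And>l. xb i - 1 \<le> xb l \<Longrightarrow> a $ l = 0" "\<And>j. xb i - 1 \<le> ub j \<Longrightarrow> b $ j = 0"
  shows "frechet_derivative f (at z) (a, b) $ i = 0"
proof -
  let ?F = "frechet_derivative f (at z)"
  define d where "d = (a, b)"
  let ?l = "\<lambda>s::real. z + s *\<^sub>R d"
  have l: "(?l has_derivative (\<lambda>s. s *\<^sub>R d)) (at 0)"
    by (auto intro!: derivative_eq_intros)
  have line: "((\<lambda>s. f (?l s) $ i) has_derivative (\<lambda>s. ?F (s *\<^sub>R d) $ i)) (at 0)"
    using diff_chain_at[OF l, of f ?F] f_has_derivative[OF z]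
    by (intro bounded_linear.has_derivative[OF bounded_linear_vec_nth]) (simp add: o_def)
  have op: "open {s. ?l s \<in> D}" and zero: "0 \<in> {s. ?l s \<in> D}"
    using z by (auto intro!: open_vimage[OF smooth_on_open[OF smooth], unfolded vimage_def] continuous_intros)
  have "f (?l s) $ i = f z $ i" if "s \<in> {s. ?l s \<in> D}" for s
  proof -
    have "?l s = (fst z + s *\<^sub>R a, snd z + s *\<^sub>R b)" by (simp add: d_def prod_eq_iff)
    then show ?thesis
      using f_component_cong[of "fst z + s *\<^sub>R a" "snd z + s *\<^sub>R b" "fst z" "snd z" i] that z assms(2,3)
      by simp
  qed
  then have "((\<lambda>s::real. f z $ i) has_derivative (\<lambda>s. ?F (s *\<^sub>R d) $ i)) (at 0)"
    by (rule has_derivative_transform_within_open[OF line op zero])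
  from has_derivative_unique[OF this has_derivative_const]
  show ?thesis unfolding d_def by (metis scaleR_one)
qed

text \<open>
  The rank condition as it is used below: the rank of the block is the number of its columns, so they
  are linearly independent.
\<close>

lemma derivative_block_injective:
  assumes k: "k < p" and z: "z \<in> D"
    and a: "\<And>l. \<not> (l \<in> H \<and> xb l = k) \<Longrightarrow> a $ l = 0" and b: "\<And>j. ub j \<noteq> k \<Longrightarrow> b $ j = 0"
    and ker: "\<And>i. xb i = k + 1 \<Longrightarrow> frechet_derivative f (at z) (a, b) $ i = 0"
  shows "a = 0" "b = 0"
proof -
  let ?A = "{l \<in> H. xb l = k}" and ?B = "{j. ub j = k}" and ?R = "{i. xb i = k + 1}"
  let ?M = "jacobian_block f z ?R ?A ?B"
  define v where "v = (\<chi> c. case c of Inl l \<Rightarrow> a $ l | Inr j \<Rightarrow> b $ j)"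
  have ab: "(\<chi> l. if l \<in> ?A then v $ Inl l else 0) = a" "(\<chi> j. if j \<in> ?B then v $ Inr j else 0) = b"
    using a b by (auto simp: v_def vec_eq_iff)
  have "v = 0"
  proof (rule full_column_rank_kernel[where M = ?M and C = "?A <+> ?B"])
    show "rank ?M = card (?A <+> ?B)"
      using block_rank[OF k z] block_card[OF k] by (simp add: card_Plus)
    show "column c ?M = 0" if "c \<notin> ?A <+> ?B" for c
      using that by (cases c) (auto simp: column_def vec_eq_iff jacobian_block_def)
    show "v $ c = 0" if "c \<notin> ?A <+> ?B" for c
      using that a b by (cases c) (auto simp: v_def)
    show "?M *v v = 0"
      using ker by (simp add: vec_eq_iff jacobian_block_mult[OF has_derivative_linear[OF f_has_derivative[OF z]]] ab
          del: mem_Collect_eq) auto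
  qed
  then show "a = 0" "b = 0" unfolding ab[symmetric] by (simp_all add: vec_eq_iff)
qed

end

section \<open>Solving for the next state and the input\<close>

text \<open>
  The enumeration \<open>\<sigma>\<close> numbers the state components outside \<open>H\<close>, that is those that belong to the
  \<open>y\<^sub>k\<close>, by the indices of the inputs.
\<close>

locale euler_outputs = structurally_flat_system f D p xb H ub
  for f :: "(real^'n::finite) \<times> (real^'m::finite) \<Rightarrow> real^'n" and D p xb H ub +
  fixes T :: real and \<sigma> :: "'m \<Rightarrow> 'n"
  assumes T: "T \<noteq> 0" and \<sigma>: "bij_betw \<sigma> UNIV (- H)"
begin

definition outputs :: "real^'n \<Rightarrow> real^'m" where
  "outputs x = (\<chi> q. x $ \<sigma> q)"

lemma bounded_linear_outputs: "bounded_linear outputs"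
  by (auto intro!: linearI simp: linear_conv_bounded_linear[symmetric] outputs_def vec_eq_iff)

lemma outputs_eq_0D: "outputs a = 0 \<Longrightarrow> l \<notin> H \<Longrightarrow> a $ l = 0"
  using \<sigma> by (auto simp: outputs_def vec_eq_iff bij_betw_def) (metis ComplI imageE)

text \<open>
  Applied to \<open>w = (x\<^sup>+, u)\<close>, this map returns the present state and the next value of the output:
  \<open>\<Theta> w = (x, y\<^sup>+)\<close> if \<open>x\<^sup>+ = x + T f (x\<^sup>+, u)\<close>. Inverting it therefore solves the Euler equation for
  both the next state and the input, given the present state and the next output.
\<close>

definition \<Theta> :: "(real^'n) \<times> (real^'m) \<Rightarrow> (real^'n) \<times> (real^'m)" where
  "\<Theta> w = (fst w - T *\<^sub>R f w, outputs (fst w))"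

lemma smooth_\<Theta>: "smooth_on D \<Theta>"
  unfolding \<Theta>_def diff_conv_add_uminus scaleR_minus_left[symmetric]
  by (intro smooth_on_Pair smooth_on_add smooth_on_bounded_linear bounded_linear_fst
      bounded_linear_compose[OF bounded_linear_outputs]
      smooth_on_open[OF smooth] smooth_on_bounded_linear_compose[OF bounded_linear_scaleR_right] smooth)

lemma derivative_\<Theta>:
  assumes "z \<in> D"
  shows "frechet_derivative \<Theta> (at z) v = (fst v - T *\<^sub>R frechet_derivative f (at z) v, outputs (fst v))"
proof -
  have "(\<Theta> has_derivative (\<lambda>v. (fst v - T *\<^sub>R frechet_derivative f (at z) v, outputs (fst v)))) (at z)"
    unfolding \<Theta>_def
    by (intro has_derivative_Pair has_derivative_diff has_derivative_fst has_derivative_ident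
        has_derivative_scaleR_right f_has_derivative assms bounded_linear.has_derivative[OF bounded_linear_outputs])
  from fun_cong[OF frechet_derivative_at[OF this], of v] show ?thesis by simp
qed

text \<open>
  The linearized form of solving the subsystems from the top. Once all blocks above \<open>t\<close> of
  \<open>(a, b)\<close> are known to vanish, only the components \<open>xhat\<^sub>t\<close> and \<open>u\<^sub>t\<close> are left in the rows of
  \<open>f\<^sub>t\<^sub>+\<^sub>1\<close>, because \<open>y\<^sub>t\<close> is fixed by the output, and the rank condition makes them vanish.
\<close>

lemma derivative_\<Theta>_upper_blocks:
  assumes z: "z \<in> D" and j: "j \<le> p"
    and \<Theta>': "frechet_derivative \<Theta> (at z) (a, b) = (r, 0)" and r: "\<And>i. j < xb i \<Longrightarrow> r $ i = 0"
  shows "(\<forall>l. j \<le> xb l \<longrightarrow> a $ l = 0) \<and> (\<forall>q. j \<le> ub q \<longrightarrow> b $ q = 0)"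
  using j
proof (induction rule: inc_induct)
  have outputs0: "outputs a = 0" and row: "a - T *\<^sub>R frechet_derivative f (at z) (a, b) = r"
    using \<Theta>' by (simp_all add: derivative_\<Theta>[OF z])
  {
    case base
    show ?case
      using outputs_eq_0D[OF outputs0] H_block ub_less by (metis not_le)
  next
    case (step t)
    let ?F = "frechet_derivative f (at z)"
    \<comment> \<open>The part of \<open>(a, b)\<close> in \<open>(xhat\<^sub>t, u\<^sub>t)\<close>; what remains is invisible to the rows of block \<open>t + 1\<close>.\<close>
    define a1 where "a1 = (\<chi> l. if l \<in> H \<and> xb l = t then a $ l else 0)"
    define b1 where "b1 = (\<chi> q. if ub q = t then b $ q else 0)"
    have a2: "(a - a1) $ l = 0" if "t \<le> xb l" for l
      using that step.IH outputs_eq_0D[OF outputs0, of l] by (auto simp: a1_def Suc_le_eq)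
    have b2: "(b - b1) $ q = 0" if "t \<le> ub q" for q
      using that step.IH by (auto simp: b1_def Suc_le_eq)
    have "?F (a1, b1) $ i = 0" if i: "xb i = t + 1" for i
    proof -
      have "?F (a, b) $ i = 0"
        using arg_cong[OF row, of "\<lambda>v. v $ i"] r[of i] i step T by auto
      moreover have "?F (a - a1, b - b1) $ i = 0"
        using i a2 b2 by (intro derivative_triangular[OF z]) auto
      moreover have "?F (a - a1, b - b1) = ?F (a, b) - ?F (a1, b1)"
        using linear_diff[OF has_derivative_linear[OF f_has_derivative[OF z]], of "(a, b)" "(a1, b1)"] by simp
      ultimately show ?thesis by simp
    qed
    then have "a1 = 0" "b1 = 0"
      by (intro derivative_block_injective[OF step.hyps(2) z, of a1 b1]; auto simp: a1_def b1_def)+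
    then show ?case using a2 b2 by simp
  }
qed

lemma inj_derivative_\<Theta>:
  assumes z: "z \<in> D"
  shows "inj (frechet_derivative \<Theta> (at z))"
proof -
  have lin: "linear (frechet_derivative \<Theta> (at z))"
    using has_derivative_linear[OF smooth_on_has_derivative[OF smooth_\<Theta> z]] .
  show ?thesis
    unfolding linear_injective_0[OF lin]
  proof clarify
    fix a b assume "frechet_derivative \<Theta> (at z) (a, b) = 0"
    then show "(a, b) = 0"
      using derivative_\<Theta>_upper_blocks[OF z, of 0 a b 0] by (simp add: zero_prod_def vec_eq_iff)
  qed
qed

end

text \<open>
  A smooth local inverse \<open>h\<close> of \<open>\<Theta>\<close> near the equilibrium, as it is supplied by the inverse
  function theorem. In this context \<open>fst (h (X, Y))\<close> is the next state and \<open>snd (h (X, Y))\<close> the input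
  if \<open>X\<close> is the present state and \<open>Y\<close> the next output.
\<close>

locale euler_inverse = euler_outputs f D p xb H ub T \<sigma>
  for f :: "(real^'n::finite) \<times> (real^'m::finite) \<Rightarrow> real^'n" and D p xb H ub T \<sigma> +
  fixes xs :: "real^'n" and us :: "real^'m" and U V h
  assumes eq: "f (xs, us) = 0"
    and U: "open U" "(xs, us) \<in> U" "U \<subseteq> D" and V: "open V"
    and hom: "homeomorphism U V \<Theta> h" and smooth_h: "smooth_on V h"
    and derivative_h: "\<And>y v. y \<in> V \<Longrightarrow>
      frechet_derivative \<Theta> (at (h y)) (frechet_derivative h (at y) v) = v"
begin

abbreviation ys :: "real^'m" where "ys \<equiv> outputs xs"

lemma \<Theta>_eq: "\<Theta> (xs, us) = (xs, ys)"
  by (simp add: \<Theta>_def eq)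

lemma \<Theta>_h: "v \<in> V \<Longrightarrow> \<Theta> (h v) = v" and h_\<Theta>: "w \<in> U \<Longrightarrow> h (\<Theta> w) = w"
  and h_U: "v \<in> V \<Longrightarrow> h v \<in> U" and \<Theta>_V: "w \<in> U \<Longrightarrow> \<Theta> w \<in> V"
  using hom by (auto simp: homeomorphism_def)

lemma ys_V: "(xs, ys) \<in> V" and h_ys: "h (xs, ys) = (xs, us)"
  using \<Theta>_V[OF U(2)] h_\<Theta>[OF U(2)] \<Theta>_eq by simp_all

text \<open>
  The triangular structure of the inverse: the blocks from \<open>j\<close> on of the next state are determined
  by the next output and by the blocks of the present state from \<open>j + 1\<close> on. Along the segment from
  \<open>X\<close> to \<open>X'\<close> the derivative of \<open>h\<close> is mapped by that of \<open>\<Theta>\<close> to \<open>(X' - X, 0)\<close>, whose upper blocks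
  are zero, so the upper blocks of \<open>h\<close> do not change.
\<close>

lemma h_upper_blocks_cong:
  assumes box: "ball xs \<delta> \<times> ball ys \<delta> \<subseteq> V"
    and X: "X \<in> ball xs \<delta>" "X' \<in> ball xs \<delta>" and Y: "Y \<in> ball ys \<delta>"
    and j: "j \<le> p" and agree: "\<And>i. j < xb i \<Longrightarrow> X $ i = X' $ i"
    and l: "j \<le> xb l"
  shows "fst (h (X, Y)) $ l = fst (h (X', Y)) $ l"
proof -
  define d where "d = (X' - X, 0 :: real^'m)"
  let ?l = "\<lambda>t::real. (X, Y) + t *\<^sub>R d"
  have seg: "?l t \<in> V" if "t \<in> {0..1}" for t
  proof -
    have "(1 - t) *\<^sub>R X + t *\<^sub>R X' \<in> ball xs \<delta>"
      using that X by (intro convexD[OF convex_ball]) auto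
    moreover have "(1 - t) *\<^sub>R X + t *\<^sub>R X' = X + t *\<^sub>R (X' - X)" by (simp add: algebra_simps)
    ultimately show ?thesis using box Y by (auto simp: d_def)
  qed
  have deriv0: "((\<lambda>t. fst (h (?l t)) $ l) has_derivative (\<lambda>s. 0)) (at t within {0..1})" if t: "t \<in> {0..1}" for t
  proof -
    let ?v = "?l t"
    let ?h = "frechet_derivative h (at ?v)"
    have hd: "(h has_derivative ?h) (at ?v)"
      using smooth_on_has_derivative[OF smooth_h seg[OF t]] .
    have "(?l has_derivative (\<lambda>s. s *\<^sub>R d)) (at t)"
      by (auto intro!: derivative_eq_intros)
    from diff_chain_at[OF this hd]
    have "((\<lambda>t. fst (h (?l t)) $ l) has_derivative (\<lambda>s. fst (?h (s *\<^sub>R d)) $ l)) (at t)"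
      by (intro bounded_linear.has_derivative[OF bounded_linear_vec_nth] has_derivative_fst) (simp add: o_def)
    moreover have "fst (?h (s *\<^sub>R d)) $ l = 0" for s
    proof -
      obtain a b where ab: "?h d = (a, b)" by fastforce
      have "frechet_derivative \<Theta> (at (h ?v)) (a, b) = (X' - X, 0)"
        using derivative_h[OF seg[OF t], of d] ab by (simp add: d_def)
      then have "a $ l = 0"
        using derivative_\<Theta>_upper_blocks[of "h ?v" j a b "X' - X"] h_U[OF seg[OF t]] U(3) j l agree by auto
      then show ?thesis by (simp add: linear_cmul[OF has_derivative_linear[OF hd]] ab)
    qed
    ultimately show ?thesis by (simp add: has_derivative_at_withinI)
  qed
  obtain c where c: "\<forall>t\<in>{0..1}. fst (h (?l t)) $ l = c"
    using has_derivative_zero_constant[OF convex_real_interval(5) deriv0] by blast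
  have "fst (h (?l 0)) $ l = c" "fst (h (?l 1)) $ l = c" by (rule bspec[OF c], simp)+
  then show ?thesis by (simp add: d_def)
qed

section \<open>Reconstruction of the state from past outputs\<close>

text \<open>
  The state at time \<open>k\<close> that is obtained by starting at the equilibrium at time \<open>k - i\<close> and then
  following the output sequence \<open>s\<close>. The wrong initial value is harmless: each step corrects one
  more block.
\<close>

primrec approx :: "nat \<Rightarrow> (int \<Rightarrow> real^'m) \<Rightarrow> int \<Rightarrow> real^'n" where
  "approx 0 s k = xs"
| "approx (Suc i) s k = fst (h (approx i s (k - 1), s k))"

lemma approx_shift: "approx i (shift m s) k = approx i s (m + k)"
  by (induction i arbitrary: k) (simp_all add: shift_def algebra_simps)

lemma approx_window:
  "(\<And>j. k - int i < j \<Longrightarrow> j \<le> k \<Longrightarrow> s j = s' j) \<Longrightarrow> approx i s k = approx i s' k"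
proof (induction i arbitrary: k)
  case (Suc i)
  have "approx i s (k - 1) = approx i s' (k - 1)" by (rule Suc.IH) (use Suc.prems in auto)
  moreover have "s k = s' k" using Suc.prems by simp
  ultimately show ?case by simp
qed simp

lemma approx_const: "approx i (\<lambda>_. ys) k = xs"
  by (induction i arbitrary: k) (simp_all add: h_ys)

text \<open>
  The constant sequence is a fixed point of the recursion, so each step is a composition of smooth
  germs at the equilibrium.
\<close>

lemma smooth_near_approx:
  "\<exists>\<delta>>0. smooth_on (ball (const_bcontfun ys) \<delta>) (\<lambda>s :: int \<Rightarrow>\<^sub>C (real^'m). approx i (apply_bcontfun s) k)"
proof (induction i arbitrary: k)
  case 0
  show ?case by (auto intro!: exI[of _ 1] smooth_on_const)
next
  case (Suc i)
  obtain \<delta> where \<delta>: "\<delta> > 0"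
    and approx_i: "smooth_on (ball (const_bcontfun ys) \<delta>) (\<lambda>s :: int \<Rightarrow>\<^sub>C (real^'m). approx i (apply_bcontfun s) (k - 1))"
    using Suc.IH by blast
  have pair: "smooth_on (ball (const_bcontfun ys) \<delta>)
      (\<lambda>s :: int \<Rightarrow>\<^sub>C (real^'m). (approx i (apply_bcontfun s) (k - 1), apply_bcontfun s k))"
    by (rule smooth_on_Pair[OF approx_i smooth_on_bounded_linear[OF bounded_linear_apply_bcontfun open_ball]])
  then show ?case
    using smooth_near_compose[OF pair \<delta> smooth_on_bounded_linear_compose[OF bounded_linear_fst smooth_h]]
    by (simp add: approx_const ys_V)
qed

text \<open>
  Only the outputs that enter the recursion are required to be close to \<open>ys\<close>. This matters for
  outputs taken from a trajectory that is controlled on a finite window only.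
\<close>

lemma approx_near:
  "\<delta> > 0 \<Longrightarrow> \<exists>\<epsilon>>0. \<forall>s k. (\<forall>j. k - int i < j \<longrightarrow> j \<le> k \<longrightarrow> s j \<in> ball ys \<epsilon>) \<longrightarrow> approx i s k \<in> ball xs \<delta>"
proof (induction i arbitrary: \<delta>)
  case 0
  then show ?case by (auto intro: exI[of _ 1])
next
  case (Suc i)
  let ?O = "V \<inter> (\<lambda>v. fst (h v)) -` ball xs \<delta>"
  have "open ?O"
    by (intro continuous_open_preimage continuous_intros smooth_on_continuous_on[OF smooth_h] V open_ball)
  moreover have "(xs, ys) \<in> ?O" using Suc.prems by (simp add: ys_V h_ys)
  ultimately obtain r where r: "r > 0" "ball xs r \<times> ball ys r \<subseteq> ?O" using open_contains_box by blast
  obtain \<epsilon> where \<epsilon>: "\<epsilon> > 0"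
    "\<And>s k. (\<forall>j. k - int i < j \<longrightarrow> j \<le> k \<longrightarrow> s j \<in> ball ys \<epsilon>) \<Longrightarrow> approx i s k \<in> ball xs r"
    using Suc.IH[OF r(1)] by blast
  have "approx (Suc i) s k \<in> ball xs \<delta>"
    if s: "\<And>j. k - int (Suc i) < j \<Longrightarrow> j \<le> k \<Longrightarrow> s j \<in> ball ys (min \<epsilon> r)" for s k
  proof -
    have "approx i s (k - 1) \<in> ball xs r" by (rule \<epsilon>(2)) (use s in force)
    moreover have "s k \<in> ball ys r" using s[of k] by simp
    ultimately have "(approx i s (k - 1), s k) \<in> ?O" using r(2) by blast
    then show ?thesis by simp
  qed
  then show ?case using r(1) \<epsilon>(1) by (intro exI[of _ "min \<epsilon> r"]) auto
qed

lemma approx_near_uniform: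
  assumes "\<delta> > 0"
  shows "\<exists>\<epsilon>>0. \<forall>i\<le>N. \<forall>s k. (\<forall>j. k - int i < j \<longrightarrow> j \<le> k \<longrightarrow> s j \<in> ball ys \<epsilon>) \<longrightarrow> approx i s k \<in> ball xs \<delta>"
proof -
  obtain e where e: "\<And>i. e i > 0"
    "\<And>i s k. (\<forall>j. k - int i < j \<longrightarrow> j \<le> k \<longrightarrow> s j \<in> ball ys (e i)) \<Longrightarrow> approx i s k \<in> ball xs \<delta>"
    using approx_near[OF assms] by metis
  let ?\<epsilon> = "Min (e ` {..N})"
  have "?\<epsilon> > 0" using e(1) by simp
  moreover have "approx i s k \<in> ball xs \<delta>"
    if "i \<le> N" "\<forall>j. k - int i < j \<longrightarrow> j \<le> k \<longrightarrow> s j \<in> ball ys ?\<epsilon>" for i s k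
  proof (rule e(2), intro allI impI)
    fix j assume "k - int i < j" "j \<le> k"
    then have "s j \<in> ball ys ?\<epsilon>" using that by blast
    moreover have "?\<epsilon> \<le> e i" using that by (intro Min_le) auto
    ultimately show "s j \<in> ball ys (e i)" unfolding mem_ball by linarith
  qed
  ultimately show ?thesis by blast
qed

text \<open>
  After \<open>m\<close> steps the approximation agrees with every state sequence near \<open>xs\<close> that follows the same outputs
  on the blocks above \<open>p - m\<close>, hence after \<open>p\<close> steps on all blocks.
\<close>

lemma approx_eq_trajectory:
  assumes box: "ball xs \<delta> \<times> ball ys \<delta> \<subseteq> V"
    and X: "\<And>m. m < p \<Longrightarrow> X (Suc m) = fst (h (X m, s (k + int (Suc m))))"
    and near: "\<And>m. m < p \<Longrightarrow> X m \<in> ball xs \<delta>" "\<And>m. m < p \<Longrightarrow> s (k + int (Suc m)) \<in> ball ys \<delta>"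
      "\<And>m. m < p \<Longrightarrow> approx m s (k + int m) \<in> ball xs \<delta>"
  shows "approx p s (k + int p) = X p"
proof -
  have "\<forall>l. p < xb l + m \<longrightarrow> approx m s (k + int m) $ l = X m $ l" if "m \<le> p" for m
    using that
  proof (induction m)
    case 0
    then show ?case by (simp add: leD[OF xb_le])
  next
    case (Suc m)
    then have m: "m < p" by simp
    have "fst (h (approx m s (k + int m), s (k + int (Suc m)))) $ l
        = fst (h (X m, s (k + int (Suc m)))) $ l" if "p < xb l + Suc m" for l
      by (rule h_upper_blocks_cong[OF box near(3)[OF m] near(1)[OF m] near(2)[OF m], of "p - m"])
         (use that Suc in auto)
    then show ?case by (simp add: X[OF m])
  qed
  then show ?thesis using xb_pos by (simp add: vec_eq_iff Suc_le_eq)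
qed

end

section \<open>Flatness\<close>

context euler_inverse
begin

text \<open>
  The state at time \<open>0\<close> follows from the outputs at the times \<open>1 - p, \<dots>, 0\<close>; the input needs in
  addition the output at time \<open>1\<close>.
\<close>

definition reconstruct :: "(int \<Rightarrow> real^'m) \<Rightarrow> (real^'n) \<times> (real^'m)" where
  "reconstruct s = (approx p s 0, snd (h (approx p s 0, s 1)))"

lemma reconstruct_shift: "reconstruct (shift k s) = (approx p s k, snd (h (approx p s k, s (k + 1))))"
  by (simp add: reconstruct_def approx_shift) (simp add: shift_def)

lemma smooth_window_reconstruct: "smooth_window_map p 1 ys reconstruct"
  unfolding smooth_window_map_def
proof (intro conjI allI impI)
  fix s s' :: "int \<Rightarrow> real^'m" assume s: "\<forall>j\<in>{- int p..int 1}. s j = s' j"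
  then have "approx p s 0 = approx p s' 0" by (intro approx_window) auto
  then show "reconstruct s = reconstruct s'" using s by (simp add: reconstruct_def)
next
  obtain \<delta> where \<delta>: "\<delta> > 0"
    and approx: "smooth_on (ball (const_bcontfun ys) \<delta>) (\<lambda>s :: int \<Rightarrow>\<^sub>C (real^'m). approx p (apply_bcontfun s) 0)"
    using smooth_near_approx by blast
  have pair: "smooth_on (ball (const_bcontfun ys) \<delta>)
      (\<lambda>s :: int \<Rightarrow>\<^sub>C (real^'m). (approx p (apply_bcontfun s) 0, apply_bcontfun s 1))"
    by (rule smooth_on_Pair[OF approx smooth_on_bounded_linear[OF bounded_linear_apply_bcontfun open_ball]])
  have "smooth_on V (\<lambda>v. (fst v, snd (h v)))"
    by (intro smooth_on_Pair smooth_on_bounded_linear bounded_linear_fst V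
        smooth_on_bounded_linear_compose[OF bounded_linear_snd smooth_h])
  from smooth_near_compose[OF pair \<delta> this]
  show "\<exists>\<delta>>0. smooth_on (ball (const_bcontfun ys) \<delta>) (\<lambda>s. reconstruct (apply_bcontfun s))"
    by (simp add: reconstruct_def approx_const ys_V)
qed

lemma smooth_window_output: "smooth_window_map 0 0 (xs, us) (\<lambda>z. outputs (fst (z 0)))"
  unfolding smooth_window_map_def
proof (intro conjI allI impI)
  show "\<exists>\<delta>>0. smooth_on (ball (const_bcontfun (xs, us)) \<delta>)
      (\<lambda>s :: int \<Rightarrow>\<^sub>C ((real^'n) \<times> (real^'m)). outputs (fst (apply_bcontfun s 0)))"
    by (intro exI[of _ 1] conjI smooth_on_bounded_linear bounded_linear_compose[OF bounded_linear_outputs]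
        bounded_linear_compose[OF bounded_linear_fst] bounded_linear_apply_bcontfun) auto
qed simp

text \<open>
  The output map is \<open>y = outputs x\<close>, which uses the window \<open>q\<^sub>1 = q\<^sub>2 = 0\<close>, and \<open>reconstruct\<close> uses
  \<open>r\<^sub>1 = p\<close> and \<open>r\<^sub>2 = 1\<close>. With \<open>r\<^sub>1 = p\<close> the window of the third identity contains the state at
  time \<open>k - p\<close>, from which the \<open>p\<close> correcting steps are counted.
\<close>

theorem flat_at_of_state_representation:
  assumes rep: "state_representation f T xs us g"
  shows "flat_at g xs us"
proof -
  obtain W R where W: "open W" "(xs, us) \<in> W" and R: "open R" "xs \<in> R"
    and rep_all: "\<forall>(x, u)\<in>W. \<forall>x'\<in>R. x' = x + T *\<^sub>R f (x', u) \<longleftrightarrow> x' = g (x, u)"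
    using rep unfolding state_representation_def by (elim exE conjE) (rule that)
  have rep': "x' = x + T *\<^sub>R f (x', u) \<longleftrightarrow> x' = g (x, u)" if "(x, u) \<in> W" "x' \<in> R" for x u x'
    using rep_all that by blast
  \<comment> \<open>Shrink so that solutions of the Euler equation given by \<open>h\<close> lie where it is equivalent to
    \<open>x\<^sup>+ = g (x, u)\<close>.\<close>
  let ?V = "V \<inter> (\<lambda>v. ((fst v, snd (h v)), fst (h v))) -` (W \<times> R)"
  have "open ?V"
    by (intro continuous_open_preimage continuous_intros smooth_on_continuous_on[OF smooth_h] V open_Times W R)
  moreover have "(xs, ys) \<in> ?V" using W R by (simp add: ys_V h_ys)
  ultimately obtain \<delta> where \<delta>: "\<delta> > 0" "ball xs \<delta> \<times> ball ys \<delta> \<subseteq> ?V"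
    using open_contains_box by blast
  have box: "ball xs \<delta> \<times> ball ys \<delta> \<subseteq> V" using \<delta>(2) by blast
  have step_g: "fst (h (X, Y)) = g (X, snd (h (X, Y)))" if "X \<in> ball xs \<delta>" "Y \<in> ball ys \<delta>" for X Y
  proof -
    have "(X, Y) \<in> ?V" using \<delta>(2) that by blast
    then have v: "(X, Y) \<in> V" "(X, snd (h (X, Y))) \<in> W" "fst (h (X, Y)) \<in> R" by auto
    have "fst (h (X, Y)) = X + T *\<^sub>R f (h (X, Y))"
      using \<Theta>_h[OF v(1)] by (simp add: \<Theta>_def algebra_simps)
    then show ?thesis using rep'[OF v(2,3)] unfolding prod.collapse by blast
  qed
  \<comment> \<open>Outputs within \<open>\<eta>\<close> of \<open>ys\<close> keep all approximations within \<open>\<delta>\<close> of \<open>xs\<close>; stage \<open>p + 1\<close> is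
    included because it is compared with stage \<open>p\<close> below.\<close>
  obtain \<eta>0 where \<eta>0: "\<eta>0 > 0" "\<And>i s k. i \<le> Suc p \<Longrightarrow>
      (\<forall>j. k - int i < j \<longrightarrow> j \<le> k \<longrightarrow> s j \<in> ball ys \<eta>0) \<Longrightarrow> approx i s k \<in> ball xs \<delta>"
    using approx_near_uniform[OF \<delta>(1), of "Suc p"] by blast
  define \<eta> where "\<eta> = min \<eta>0 \<delta>"
  have \<eta>: "\<eta> > 0" "\<eta> \<le> \<eta>0" "\<eta> \<le> \<delta>" using \<eta>0(1) \<delta>(1) by (auto simp: \<eta>_def)
  have near: "approx i s k \<in> ball xs \<delta>"
    if "i \<le> Suc p" "\<And>j. k - int i < j \<Longrightarrow> j \<le> k \<Longrightarrow> s j \<in> ball ys \<eta>" for i s k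
    using \<eta>0(2)[of i k s] that subset_ball[OF \<eta>(2)] by blast
  \<comment> \<open>States and inputs within \<open>\<rho>\<close> of the equilibrium can be recovered by \<open>h\<close> from their image under
    \<open>\<Theta>\<close>, and the outputs of such states are within \<open>\<eta>\<close>.\<close>
  have "open (U \<inter> W \<inter> (R \<inter> outputs -` ball ys \<eta>) \<times> UNIV)"
    by (intro open_Int open_Times open_UNIV open_vimage open_ball U W R
        linear_continuous_on[OF bounded_linear_outputs])
  moreover have "(xs, us) \<in> U \<inter> W \<inter> (R \<inter> outputs -` ball ys \<eta>) \<times> UNIV"
    using U W R \<eta> by simp
  ultimately obtain \<rho> where \<rho>: "\<rho> > 0"
    "ball xs \<rho> \<times> ball us \<rho> \<subseteq> U \<inter> W \<inter> (R \<inter> outputs -` ball ys \<eta>) \<times> UNIV"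
    using open_contains_box by blast
  define \<epsilon> where "\<epsilon> = min \<eta> (min \<rho> \<delta>)"
  have \<epsilon>: "\<epsilon> > 0" "\<epsilon> \<le> \<eta>" "\<epsilon> \<le> \<rho>" "\<epsilon> \<le> \<delta>" using \<eta> \<rho> \<delta> by (auto simp: \<epsilon>_def)
  have output_step: "fst (reconstruct (shift (k + 1) y)) = g (reconstruct (shift k y))"
    and output_id: "outputs (fst (reconstruct (shift k y))) = y k"
    if y: "\<forall>j. dist (y j) ys < \<epsilon>" for y k
  proof -
    have y\<eta>: "y j \<in> ball ys \<eta>" and y\<delta>: "y j \<in> ball ys \<delta>" for j
      using y[rule_format, of j] \<epsilon> by (auto simp: dist_commute)
    have x\<delta>: "approx i y j \<in> ball xs \<delta>" if "i \<le> Suc p" for i j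
      using near that y\<eta> by blast
    \<comment> \<open>The reconstructed states form a trajectory: \<open>p\<close> and \<open>p + 1\<close> correcting steps give the
      same state, as both are correct in all \<open>p\<close> blocks.\<close>
    have stable: "approx p y j = fst (h (approx p y (j - 1), y j))" for j
    proof -
      have "approx p y (j - int p + int p) = approx (Suc p) y (j - int p + int p)"
      proof (rule approx_eq_trajectory[OF box, where X = "\<lambda>m. approx (Suc m) y (j - int p + int m)"])
        fix m assume m: "m < p"
        show "approx (Suc (Suc m)) y (j - int p + int (Suc m)) =
            fst (h (approx (Suc m) y (j - int p + int m), y (j - int p + int (Suc m))))"
          by (simp add: algebra_simps)
        show "approx (Suc m) y (j - int p + int m) \<in> ball xs \<delta>" "approx m y (j - int p + int m) \<in> ball xs \<delta>"
          by (rule x\<delta>; use m in simp)+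
      qed (rule y\<delta>)
      then show ?thesis by simp
    qed
    show "fst (reconstruct (shift (k + 1) y)) = g (reconstruct (shift k y))"
      using stable[of "k + 1"] step_g[OF x\<delta> y\<delta>, of p k "k + 1"] by (simp add: reconstruct_shift)
    have "(approx p y (k - 1), y k) \<in> V" using box x\<delta> y\<delta> by auto
    from \<Theta>_h[OF this] show "outputs (fst (reconstruct (shift k y))) = y k"
      using stable[of k] by (simp add: reconstruct_shift \<Theta>_def)
  qed
  have trajectory_id: "reconstruct (\<lambda>j. outputs (fst (shift (k + j) z 0))) = z k"
    if near_z: "\<forall>j\<in>{k - int (p + 0)..k + int (1 + 0)}. dist (z j) (xs, us) < \<epsilon>"
      and step: "\<forall>j\<in>{k - int (p + 0)..<k + int (1 + 0)}. fst (z (j + 1)) = g (z j)" for z k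
  proof -
    define y where "y j = outputs (fst (z (k + j)))" for j
    define k0 where "k0 = - int p"
    have z: "fst (z j) \<in> ball xs \<epsilon>" "snd (z j) \<in> ball us \<epsilon>" if "k - int p \<le> j" "j \<le> k + 1" for j
      using near_z that dist_fst_le[of "z j" "(xs, us)"] dist_snd_le[of "z j" "(xs, us)"]
      by (auto simp: dist_commute intro: le_less_trans)
    have zO: "(fst (z j), snd (z i)) \<in> U \<inter> W" "fst (z j) \<in> R" "outputs (fst (z j)) \<in> ball ys \<eta>"
      if "k - int p \<le> j" "j \<le> k + 1" "k - int p \<le> i" "i \<le> k + 1" for i j
    proof -
      have "(fst (z j), snd (z i)) \<in> ball xs \<rho> \<times> ball us \<rho>"
        using z[OF that(1,2)] z[OF that(3,4)] \<epsilon>(3) by auto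
      then show "(fst (z j), snd (z i)) \<in> U \<inter> W" "fst (z j) \<in> R" "outputs (fst (z j)) \<in> ball ys \<eta>"
        using \<rho>(2) by blast+
    qed
    have y: "y j \<in> ball ys \<eta>" if "- int p \<le> j" "j \<le> 1" for j
      using zO(3)[of "k + j" "k + j"] that by (simp add: y_def)
    have h_z: "h (fst (z (k + j)), y (j + 1)) = (fst (z (k + j + 1)), snd (z (k + j)))"
      if j: "- int p \<le> j" "j \<le> 0" for j
    proof -
      let ?w = "(fst (z (k + j + 1)), snd (z (k + j)))"
      have "z (k + j) \<in> W" "fst (z (k + j + 1)) \<in> R" "?w \<in> U"
        using zO(1)[of "k + j" "k + j"] zO(1,2)[of "k + j + 1" "k + j"] j by simp_all
      moreover have "fst (z (k + j + 1)) = g (fst (z (k + j)), snd (z (k + j)))" using step j by simp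
      ultimately have "fst (z (k + j + 1)) = fst (z (k + j)) + T *\<^sub>R f ?w"
        using rep'[of "fst (z (k + j))" "snd (z (k + j))"] by simp
      then have "fst (z (k + j + 1)) - T *\<^sub>R f ?w = fst (z (k + j))" by (simp only: diff_eq_eq)
      then have "\<Theta> ?w = (fst (z (k + j)), y (j + 1))" by (simp add: \<Theta>_def y_def add.assoc)
      then show ?thesis using h_\<Theta>[OF \<open>?w \<in> U\<close>] by simp
    qed
    have "approx p y (k0 + int p) = fst (z (k + (k0 + int p)))"
    proof (rule approx_eq_trajectory[OF box, where X = "\<lambda>m. fst (z (k + (k0 + int m)))"])
      fix m assume m: "m < p"
      show "fst (z (k + (k0 + int (Suc m)))) = fst (h (fst (z (k + (k0 + int m))), y (k0 + int (Suc m))))"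
        using h_z[of "k0 + int m"] m by (simp add: k0_def algebra_simps)
      show "fst (z (k + (k0 + int m))) \<in> ball xs \<delta>"
        using z(1)[of "k + (k0 + int m)"] \<epsilon>(4) m by (auto simp: k0_def)
      show "y (k0 + int (Suc m)) \<in> ball ys \<delta>"
        using y[of "k0 + int (Suc m)"] \<eta>(3) m by (auto simp: k0_def)
      show "approx m y (k0 + int m) \<in> ball xs \<delta>"
        by (rule near) (use m y in \<open>auto simp: k0_def simp del: mem_ball\<close>)
    qed
    then have "approx p y 0 = fst (z k)" by (simp add: k0_def)
    then have "reconstruct y = z k" using h_z[of 0] by (simp add: reconstruct_def)
    then show ?thesis by (simp add: y_def[abs_def] shift_def)
  qed
  show ?thesis
    unfolding flat_at_def
  proof (intro conjI exI)
    show "submersive_near g (xs, us)"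
      using state_representation_submersive[OF smooth _ eq rep] U by blast
    show "reconstruct (\<lambda>_. ys) = (xs, us)" by (simp add: reconstruct_def approx_const h_ys)
    show "\<forall>y k. (\<forall>j. dist (y j) ys < \<epsilon>) \<longrightarrow>
        fst (reconstruct (shift (k + 1) y)) = g (reconstruct (shift k y))"
      using output_step by blast
    show "\<forall>y k. (\<forall>j. dist (y j) ys < \<epsilon>) \<longrightarrow> outputs (fst (reconstruct (shift (k + 0) y))) = y k"
      using output_id by simp
    show "\<forall>z k. (\<forall>j\<in>{k - int (p + 0)..k + int (1 + 0)}. dist (z j) (xs, us) < \<epsilon>) \<and>
        (\<forall>j\<in>{k - int (p + 0)..<k + int (1 + 0)}. fst (z (j + 1)) = g (z j)) \<longrightarrow>
        reconstruct (\<lambda>j. outputs (fst (shift (k + j) z 0))) = z k"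
      using trajectory_id by blast
  qed (use \<epsilon>(1) smooth_window_reconstruct smooth_window_output in auto)
qed

end

theorem lemma4:
  fixes f :: "(real^'n) \<times> (real^'m) \<Rightarrow> real^'n"
    and D :: "((real^'n) \<times> (real^'m)) set"
    and xs :: "real^'n" and us :: "real^'m"
    and p :: nat and xb :: "'n::finite \<Rightarrow> nat" and H :: "'n set" and ub :: "'m::finite \<Rightarrow> nat"
  assumes "(xs, us) \<in> D"
    and "smooth_on D f"
    and "structurally_flat_triangular_on D p xb H ub f"
    and "f (xs, us) = 0"
  shows "(\<forall>\<^sub>F T in at_right (0::real). \<exists>g. state_representation f T xs us g) \<and>
         (\<forall>T>0. \<forall>g. state_representation f T xs us g \<longrightarrow> flat_at g xs us)"
proof (intro conjI allI impI)
  show "\<forall>\<^sub>F T in at_right (0::real). \<exists>g. state_representation f T xs us g"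
    using eventually_state_representation[OF assms(2,1,4)] .
  fix T :: real and g assume "T > 0" and rep: "state_representation f T xs us g"
  interpret structurally_flat_system f D p xb H ub
    by unfold_locales (rule assms)+
  obtain \<sigma> :: "'m \<Rightarrow> 'n" where \<sigma>: "bij_betw \<sigma> UNIV (- H)" using ex_output_enumeration by blast
  interpret euler_outputs f D p xb H ub T \<sigma>
    by unfold_locales (use \<open>T > 0\<close> \<sigma> in auto)
  obtain U V h where "open U" "(xs, us) \<in> U" "U \<subseteq> D" "open V" "homeomorphism U V \<Theta> h" "smooth_on V h"
    "\<And>y v. y \<in> V \<Longrightarrow> frechet_derivative \<Theta> (at (h y)) (frechet_derivative h (at y) v) = v"
    using smooth_inverse_function[OF smooth_\<Theta> assms(1) inj_derivative_\<Theta>[OF assms(1)]] by metis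
  then interpret euler_inverse f D p xb H ub T \<sigma> xs us U V h
    by unfold_locales (use assms(4) in auto)
  show "flat_at g xs us" using flat_at_of_state_representation[OF rep] .
qed

end
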